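(* Sensitivity to the initial conditions and equicontinuity are decidable for linear cellular automata over $\mathbb{K}^n$, where $\mathbb{K}=\mathbb{Z}/m\mathbb{Z}$. That is, there is an algorithm which, given positive integers $m,n$, a radius $r\in\mathbb{N}$ and matrices $A_{-r},\ldots,A_r\in(\mathbb{Z}/m\mathbb{Z})^{n\times n}$, decides whether the linear cellular automaton over $(\mathbb{Z}/m\mathbb{Z})^n$ defined by these matrices is sensitive to the initial conditions; and there is likewise an algorithm which decides whether it is equicontinuous.
   Context: $\mathbb{N}=\{0,1,2,\ldots\}$. For a finite set $S$, the configuration space $S^{\mathbb{Z}}$ is the set of maps $c:\mathbb{Z}\to S$, $i\mapsto c_i$, equipped with the distance $d(c,c')=2^{-\ell}$, where $\ell=\min\{i\in\mathbb{N}: c_i\ne c'_i\text{ or }c_{-i}\neq c'_{-i}\}$ (and $d(c,c)=0$). Linear cellular automaton (LCA): let $\mathbb{K}=\mathbb{Z}/m\mathbb{Z}$. The LCA over $\mathbb{K}^n$ of radius $r$ defined by matrices $A_{-r},\ldots,A_r\in\mathbb{K}^{n\times n}$ is the map $F:(\mathbb{K}^n)^{\mathbb{Z}}\to(\mathbb{K}^n)^{\mathbb{Z}}$ given by $F(c)_i=\sum_{z=-r}^{r}A_z\cdot c_{i+z}$ for all $c$ and all $i\in\mathbb{Z}$. Let $F:\mathcal{X}\to\mathcal{X}$ be a continuous self-map of a metric space $(\mathcal{X},d)$. $F$ is sensitive to the initial conditions if there exists $\varepsilon>0$ such that for any $x\in\mathcal{X}$ and any $\delta>0$ there is $y\in\mathcal{X}$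 with $0<d(y,x)<\delta$ and $d(F^k(y),F^k(x))>\varepsilon$ for some $k\in\mathbb{N}$. $F$ is equicontinuous if for every $\varepsilon>0$ there is $\delta>0$ such that for all $x,y\in\mathcal{X}$, $d(x,y)<\delta$ implies $d(F^k(x),F^k(y))<\varepsilon$ for all $k\in\mathbb{N}$. *)

theory Defs
  imports
    "HOL-Analysis.Abstract_Metric_Spaces"
    "HOL-Library.Nat_Bijection"
    "Jordan_Normal_Form.Matrix"
begin

unbundle no vec_syntax

section \<open>Decidability\<close>

text \<open>
  The model of computation is that of Kleene's partial recursive functions. A term of type
  \<open>recf\<close> is a program, and \<open>computes f xs y\<close> says that \<open>f\<close>, started on the arguments \<open>xs\<close>,
  halts with output \<open>y\<close>. In \<open>Prec f g\<close> and \<open>Mu f\<close> the recursion (search) variable is the first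
  argument; the step function \<open>g\<close> gets the counter, the previous value and the parameters.
\<close>

datatype recf =
    Zero
  | Succ
  | Proj nat
  | Comp recf "recf list"
  | Prec recf recf
  | Mu recf

inductive computes :: "recf \<Rightarrow> nat list \<Rightarrow> nat \<Rightarrow> bool" where
  Zero: "computes Zero xs 0"
| Succ: "computes Succ [x] (Suc x)"
| Proj: "i < length xs \<Longrightarrow> computes (Proj i) xs (xs ! i)"
| Comp: "length ys = length gs \<Longrightarrow> (\<And>i. i < length gs \<Longrightarrow> computes (gs ! i) xs (ys ! i)) \<Longrightarrow>
    computes f ys z \<Longrightarrow> computes (Comp f gs) xs z"
| Prec_0: "computes f xs y \<Longrightarrow> computes (Prec f g) (0 # xs) y"
| Prec_Suc: "computes (Prec f g) (x # xs) y \<Longrightarrow> computes g (x # y # xs) z \<Longrightarrow>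
    computes (Prec f g) (Suc x # xs) z"
| Mu: "computes f (y # xs) 0 \<Longrightarrow> (\<And>z. z < y \<Longrightarrow> \<exists>v. computes f (z # xs) (Suc v)) \<Longrightarrow>
    computes (Mu f) xs y"

inductive_cases computes_ZeroE: "computes Zero xs y"
inductive_cases computes_SuccE: "computes Succ xs y"
inductive_cases computes_ProjE: "computes (Proj i) xs y"
inductive_cases computes_CompE: "computes (Comp f gs) xs y"
inductive_cases computes_Prec0E: "computes (Prec f g) (0 # xs) y"
inductive_cases computes_PrecSucE: "computes (Prec f g) (Suc x # xs) y"
inductive_cases computes_MuE: "computes (Mu f) xs y"

lemma computes_deterministic:
  assumes "computes f xs y" "computes f xs y'"
  shows "y = y'"
  using assms
proof (induction arbitrary: y' rule: computes.induct)
  case (Zero xs)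
  then show ?case by (auto elim: computes_ZeroE)
next
  case (Succ x)
  then show ?case by (auto elim: computes_SuccE)
next
  case (Proj i xs)
  then show ?case by (auto elim: computes_ProjE)
next
  case (Comp ys gs xs f z)
  from Comp.prems obtain ys' where "length ys' = length gs"
    "\<And>i. i < length gs \<Longrightarrow> computes (gs ! i) xs (ys' ! i)" "computes f ys' y'"
    by (auto elim: computes_CompE)
  moreover from this have "ys = ys'"
    using Comp by (intro nth_equalityI) auto
  ultimately show ?case using Comp by auto
next
  case (Prec_0 f xs y g)
  from Prec_0.prems have "computes f xs y'" by (rule computes_Prec0E)
  then show ?case by (rule Prec_0.IH)
next
  case (Prec_Suc f g x xs y z)
  from Prec_Suc.prems obtain w where "computes (Prec f g) (x # xs) w" "computes g (x # w # xs) y'"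
    by (auto elim: computes_PrecSucE)
  then show ?case using Prec_Suc.IH by blast
next
  case (Mu f y xs)
  from Mu.prems have y': "computes f (y' # xs) 0" "\<And>z. z < y' \<Longrightarrow> \<exists>v. computes f (z # xs) (Suc v)"
    by (auto elim: computes_MuE)
  show ?case
  proof (rule linorder_cases[of y y'])
    assume "y < y'"
    with y'(2) obtain v where "computes f (y # xs) (Suc v)" by blast
    then show ?thesis using Mu.IH(1) by blast
  next
    assume "y' < y"
    then show ?thesis using Mu.IH(2) y'(1) by blast
  qed
qed

text \<open>
  The problem of deciding \<open>P\<close> on the set \<open>I\<close> of instances, each instance \<open>x\<close> being given to the
  program as the number \<open>code x\<close>.
\<close>

definition decidable_on :: "'a set \<Rightarrow> ('a \<Rightarrow> nat) \<Rightarrow> ('a \<Rightarrow> bool) \<Rightarrow> bool" where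
  "decidable_on I code P \<longleftrightarrow>
    (\<exists>f. \<forall>x\<in>I. computes f [code x] (if P x then 1 else 0))"


section \<open>Sensitivity and equicontinuity\<close>

context Metric_space
begin

definition sensitive :: "('a \<Rightarrow> 'a) \<Rightarrow> bool" where
  "sensitive F \<longleftrightarrow>
    (\<exists>\<epsilon>>0. \<forall>x\<in>M. \<forall>\<delta>>0. \<exists>y\<in>M.
      0 < d y x \<and> d y x < \<delta> \<and> (\<exists>k. d ((F ^^ k) y) ((F ^^ k) x) > \<epsilon>))"

definition equicontinuous :: "('a \<Rightarrow> 'a) \<Rightarrow> bool" where
  "equicontinuous F \<longleftrightarrow>
    (\<forall>\<epsilon>>0. \<exists>\<delta>>0. \<forall>x\<in>M. \<forall>y\<in>M. d x y < \<delta> \<longrightarrow> (\<forall>k. d ((F ^^ k) x) ((F ^^ k) y) < \<epsilon>))"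

end


section \<open>Configurations\<close>

definition configs :: "'s set \<Rightarrow> (int \<Rightarrow> 's) set" where
  "configs S = UNIV \<rightarrow> S"

definition config_dist :: "(int \<Rightarrow> 's) \<Rightarrow> (int \<Rightarrow> 's) \<Rightarrow> real" where
  "config_dist c c' =
    (if c = c' then 0
     else (1 / 2) ^ (LEAST i. c (int i) \<noteq> c' (int i) \<or> c (- int i) \<noteq> c' (- int i)))"

lemma config_dist_less_iff:
  "config_dist c c' < (1 / 2) ^ l \<longleftrightarrow> (\<forall>i. \<bar>i\<bar> \<le> int l \<longrightarrow> c i = c' i)"
proof (cases "c = c'")
  case True
  then show ?thesis by (simp add: config_dist_def)
next
  case False
  define P where "P i \<longleftrightarrow> c (int i) \<noteq> c' (int i) \<or> c (- int i) \<noteq> c' (- int i)" for i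
  from False obtain j where "c j \<noteq> c' j" by auto
  then have "P (nat \<bar>j\<bar>)" by (auto simp: P_def abs_if)
  then have L: "P (LEAST i. P i)" by (rule LeastI)
  have "config_dist c c' < (1 / 2) ^ l \<longleftrightarrow> l < (LEAST i. P i)"
    using False unfolding config_dist_def P_def by (simp add: power_strict_decreasing_iff)
  also have "\<dots> \<longleftrightarrow> (\<forall>i\<le>l. \<not> P i)"
    using L not_less_Least[of _ P] by (meson le_less_trans not_le)
  also have "\<dots> \<longleftrightarrow> (\<forall>i. \<bar>i\<bar> \<le> int l \<longrightarrow> c i = c' i)"
  proof safe
    fix i assume "\<forall>i\<le>l. \<not> P i" "\<bar>i\<bar> \<le> int l"
    then have "\<not> P (nat \<bar>i\<bar>)" by auto
    then show "c i = c' i" by (auto simp: P_def abs_if split: if_splits)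
  qed (auto simp: P_def)
  finally show ?thesis .
qed

lemma config_dist_cases: "config_dist c c' = 0 \<or> (\<exists>l. config_dist c c' = (1 / 2) ^ l)"
  by (auto simp: config_dist_def)

lemma config_dist_ultrametric:
  "config_dist c c'' \<le> max (config_dist c c') (config_dist c' c'')"
proof (rule ccontr)
  assume *: "\<not> ?thesis"
  moreover have "0 \<le> config_dist c c'" by (simp add: config_dist_def)
  ultimately have "config_dist c c'' \<noteq> 0" by linarith
  with config_dist_cases obtain l where l: "config_dist c c'' = (1 / 2) ^ l" by blast
  with * have "config_dist c c' < (1 / 2) ^ l" "config_dist c' c'' < (1 / 2) ^ l" by auto
  then have "config_dist c c'' < (1 / 2) ^ l"
    unfolding config_dist_less_iff by simp
  with l show False by simp
qed

lemma Metric_space_configs: "Metric_space (configs S) config_dist"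
proof
  fix c c' c'' :: "int \<Rightarrow> 's"
  show nonneg: "0 \<le> config_dist c c'" for c c' :: "int \<Rightarrow> 's" by (simp add: config_dist_def)
  show "config_dist c c' = config_dist c' c"
    by (simp only: config_dist_def eq_commute[of c c'] eq_commute[of "c _" "c' _"])
  show "config_dist c c' = 0 \<longleftrightarrow> c = c'"
    by (simp add: config_dist_def)
  show "config_dist c c'' \<le> config_dist c c' + config_dist c' c''"
    using config_dist_ultrametric[of c c'' c'] nonneg[of c c'] nonneg[of c' c''] by linarith
qed


section \<open>Linear cellular automata over \<open>(\<int>/m\<int>)\<^sup>n\<close>\<close>

text \<open>
  The elements of \<open>\<int>/m\<int>\<close> are represented by their least nonnegative residues \<open>0, \<dots>, m - 1\<close>
  (for \<open>m = 1\<close> this is the zero ring).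
\<close>

definition residue_vecs :: "nat \<Rightarrow> nat \<Rightarrow> nat vec set" where
  "residue_vecs m n = {v \<in> carrier_vec n. \<forall>j<n. v $ j < m}"

definition residue_mats :: "nat \<Rightarrow> nat \<Rightarrow> nat mat set" where
  "residue_mats m n = {A \<in> carrier_mat n n. \<forall>i<n. \<forall>j<n. A $$ (i, j) < m}"

definition lca :: "nat \<Rightarrow> nat \<Rightarrow> nat \<Rightarrow> (int \<Rightarrow> nat mat) \<Rightarrow> (int \<Rightarrow> nat vec) \<Rightarrow> (int \<Rightarrow> nat vec)" where
  "lca m n r A c =
    (\<lambda>i. vec n (\<lambda>j. (\<Sum>z = - int r..int r. (A z *\<^sub>v c (i + z)) $ j) mod m))"

lemma lca_in_configs:
  assumes "m > 0"
  shows "lca m n r A \<in> configs (residue_vecs m n) \<rightarrow> configs (residue_vecs m n)"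
  using assms by (auto simp: lca_def configs_def residue_vecs_def)

lemma continuous_map_lca:
  assumes "m > 0"
  shows "continuous_map
    (Metric_space.mtopology (configs (residue_vecs m n)) config_dist)
    (Metric_space.mtopology (configs (residue_vecs m n)) config_dist) (lca m n r A)"
proof -
  interpret Metric_space "configs (residue_vecs m n)" config_dist
    by (rule Metric_space_configs)
  have "\<exists>\<delta>>0. \<forall>y. config_dist x y < \<delta> \<longrightarrow> config_dist (lca m n r A x) (lca m n r A y) < \<epsilon>"
    if "\<epsilon> > 0" for x \<epsilon>
  proof -
    from that obtain l where l: "(1 / 2) ^ l < \<epsilon>"
      using real_arch_pow_inv[of \<epsilon> "1 / 2"] by auto
    have "config_dist (lca m n r A x) (lca m n r A y) < (1 / 2) ^ l"
      if "config_dist x y < (1 / 2) ^ (l + r)" for y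
      using that unfolding config_dist_less_iff lca_def
      by (auto intro!: arg_cong[where f = "vec n"] ext arg_cong[where f = "\<lambda>a. a mod m"] sum.cong)
    with l show ?thesis
      by (intro exI[of _ "(1 / 2) ^ (l + r)"]) force
  qed
  then show ?thesis
    unfolding metric_continuous_map[OF Metric_space_configs]
    using lca_in_configs[OF assms] by blast
qed


section \<open>Instances of the decision problems\<close>

text \<open>
  An instance is a tuple \<open>(m, n, r, A)\<close>; the values of \<open>A\<close> outside \<open>{- r..r}\<close> affect neither
  the automaton nor the code. The code lists \<open>m\<close>, \<open>n\<close>, \<open>r\<close> and then the entries of
  \<open>A (- r), \<dots>, A r\<close>, each matrix row by row.
\<close>

type_synonym lca_data = "nat \<times> nat \<times> nat \<times> (int \<Rightarrow> nat mat)"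

definition lca_instances :: "lca_data set" where
  "lca_instances =
    {(m, n, r, A). m > 0 \<and> n > 0 \<and> (\<forall>z\<in>{- int r..int r}. A z \<in> residue_mats m n)}"

definition lca_code :: "lca_data \<Rightarrow> nat" where
  "lca_code = (\<lambda>(m, n, r, A).
    list_encode (m # n # r # concat (map (\<lambda>z. concat (mat_to_list (A z))) [- int r..int r])))"

definition lca_sensitive :: "lca_data \<Rightarrow> bool" where
  "lca_sensitive = (\<lambda>(m, n, r, A).
    Metric_space.sensitive (configs (residue_vecs m n)) config_dist (lca m n r A))"

definition lca_equicontinuous :: "lca_data \<Rightarrow> bool" where
  "lca_equicontinuous = (\<lambda>(m, n, r, A).
    Metric_space.equicontinuous (configs (residue_vecs m n)) config_dist (lca m n r A))"

end

theory Submission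
  imports Defs "HOL-Computational_Algebra.Primes" "HOL-Library.Function_Algebras" "HOL-Library.FuncSet"
begin

text \<open>
  Equicontinuity of a linear automaton \<open>F\<close> means that the powers of \<open>F\<close> have bounded radius, hence
  that there are only finitely many of them; otherwise linearity makes \<open>F\<close> sensitive. So it suffices
  to find a computable \<open>N\<close> such that \<open>F ^ N = F ^ (2 * N)\<close> whenever \<open>F\<close> has finitely many powers.

  On constant configurations \<open>F\<close> acts as an \<open>n \<times> n\<close> matrix over \<open>\<int>/m\<int>\<close>, so \<open>E = F ^ b - F ^ a\<close>
  kills them for some \<open>a < b \<le> m ^ (n * n)\<close>. Then \<open>E ^ k\<close> kills all configurations \<open>c\<close> whose \<open>k\<close>-th
  difference is \<open>0\<close>. Such a \<open>c\<close> can be prescribed on a window of length \<open>k\<close>; since the radii of the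
  powers of \<open>E\<close> are bounded, \<open>E\<close> is nilpotent. Modulo a prime, \<open>E\<close> is a nilpotent \<open>n \<times> n\<close> matrix
  over an integral domain, so \<open>E ^ n = 0\<close>; therefore \<open>E ^ (n * m) = 0\<close> modulo \<open>m\<close>. Expanding
  \<open>F ^ (b * t) = (F ^ a + E) ^ t\<close> for \<open>t = m * fact (n * m)\<close> gives \<open>F ^ (b * t) = F ^ (a * t)\<close>, and
  \<open>N = t * fact (m ^ (n * n))\<close> will do.

  Equality of \<open>F ^ N\<close> and \<open>F ^ (2 * N)\<close> can be tested on the finitely many configurations of spatial
  period \<open>4 * N * r + 1\<close>, written as numbers in base \<open>m\<close>.
\<close>

section \<open>Local linear operators on integer configurations\<close>

text \<open>
  The first argument is the position. For a fixed \<open>n\<close> only the components \<open>j < n\<close> matter: locality and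
  divisibility below say nothing about the others.
\<close>

type_synonym int_config = "int \<Rightarrow> nat \<Rightarrow> int"

definition shift :: "int \<Rightarrow> (int \<Rightarrow> 'a) \<Rightarrow> int \<Rightarrow> 'a" where
  "shift s v = (\<lambda>i. v (i + s))"

definition smul :: "int \<Rightarrow> int_config \<Rightarrow> int_config" where
  "smul k v = (\<lambda>i j. k * v i j)"

definition vanishes_mod :: "nat \<Rightarrow> int \<Rightarrow> int_config \<Rightarrow> bool" where
  "vanishes_mod n d v \<longleftrightarrow> (\<forall>i. \<forall>j<n. d dvd v i j)"

definition local_linear :: "nat \<Rightarrow> nat \<Rightarrow> (int_config \<Rightarrow> int_config) \<Rightarrow> bool" where
  "local_linear n \<rho> T \<longleftrightarrow>
    (\<forall>v w. T (v + w) = T v + T w) \<and> (\<forall>k v. T (smul k v) = smul k (T v)) \<and>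
    (\<forall>s v. T (shift s v) = shift s (T v)) \<and>
    (\<forall>v. (\<forall>i j. \<bar>i\<bar> \<le> int \<rho> \<longrightarrow> j < n \<longrightarrow> v i j = 0) \<longrightarrow> (\<forall>j<n. T v 0 j = 0))"

lemma shift_apply [simp]: "shift s v i = v (i + s)"
  by (simp add: shift_def)

lemma smul_apply [simp]: "smul k v i j = k * v i j"
  by (simp add: smul_def)

lemma sum_fun_apply: "(\<Sum>x\<in>S. f x) i = (\<Sum>x\<in>S. f x i)"
  by (induction S rule: infinite_finite_induct) auto

section \<open>Divisibility of the relevant components\<close>

lemma vanishes_mod_0 [simp]: "vanishes_mod n d 0"
  by (simp add: vanishes_mod_def)

lemma vanishes_mod_add: "vanishes_mod n d v \<Longrightarrow> vanishes_mod n d w \<Longrightarrow> vanishes_mod n d (v + w)"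
  by (simp add: vanishes_mod_def)

lemma vanishes_mod_diff: "vanishes_mod n d v \<Longrightarrow> vanishes_mod n d w \<Longrightarrow> vanishes_mod n d (v - w)"
  by (simp add: vanishes_mod_def)

lemma vanishes_mod_diff_trans:
  "vanishes_mod n d (u - v) \<Longrightarrow> vanishes_mod n d (v - w) \<Longrightarrow> vanishes_mod n d (u - w)"
  using vanishes_mod_add[of n d "u - v" "v - w"] by simp

lemma vanishes_mod_diff_commute: "vanishes_mod n d (v - w) \<longleftrightarrow> vanishes_mod n d (w - v)"
  by (simp add: vanishes_mod_def dvd_diff_commute)

lemma vanishes_mod_smul: "vanishes_mod n d v \<Longrightarrow> vanishes_mod n d (smul k v)"
  by (simp add: vanishes_mod_def)

lemma vanishes_mod_sum:
  "(\<And>x. x \<in> S \<Longrightarrow> vanishes_mod n d (f x)) \<Longrightarrow> vanishes_mod n d (\<Sum>x\<in>S. f x)"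
  by (induction S rule: infinite_finite_induct) (auto intro: vanishes_mod_add)

lemma vanishes_mod_dvd: "d dvd e \<Longrightarrow> vanishes_mod n e v \<Longrightarrow> vanishes_mod n d v"
  by (meson dvd_trans vanishes_mod_def)

section \<open>Consequences of linearity and locality\<close>

context
  fixes n \<rho> T
  assumes T: "local_linear n \<rho> T"
begin

lemma local_linear_add: "T (v + w) = T v + T w"
  and local_linear_smul: "T (smul k v) = smul k (T v)"
  and local_linear_shift: "T (shift s v) = shift s (T v)"
  using T by (simp_all add: local_linear_def)

lemma local_linear_local_0:
  "(\<And>i j. \<bar>i\<bar> \<le> int \<rho> \<Longrightarrow> j < n \<Longrightarrow> v i j = 0) \<Longrightarrow> j < n \<Longrightarrow> T v 0 j = 0"
  using T by (simp add: local_linear_def)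

lemma local_linear_0: "T 0 = 0"
  using local_linear_add[of 0 0] by simp

lemma local_linear_diff: "T (v - w) = T v - T w"
  using local_linear_add[of "v - w" w] by (simp add: algebra_simps)

lemma local_linear_sum: "T (\<Sum>x\<in>S. f x) = (\<Sum>x\<in>S. T (f x))"
  by (induction S rule: infinite_finite_induct) (simp_all only: sum.infinite sum.empty sum.insert local_linear_0 local_linear_add not_False_eq_True)

text \<open>Translation moves position \<open>i\<close> to \<open>0\<close>, where locality applies
  to \<open>v - w\<close>.\<close>

lemma local_linear_local:
  assumes "\<And>i' j. \<bar>i' - i\<bar> \<le> int \<rho> \<Longrightarrow> j < n \<Longrightarrow> v i' j = w i' j" "j < n"
  shows "T v i j = T w i j"
proof -
  have "T (shift i (v - w)) 0 j = 0"
    using assms by (intro local_linear_local_0) auto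
  then show ?thesis
    by (simp add: local_linear_shift local_linear_diff)
qed

text \<open>On the components below \<open>n\<close>, \<open>v\<close> agrees with \<open>d\<close>
  times an integer configuration. Locality allows the replacement, and homogeneity extracts the
  factor \<open>d\<close>.\<close>

lemma local_linear_vanishes_mod:
  assumes "vanishes_mod n d v"
  shows "vanishes_mod n d (T v)"
  unfolding vanishes_mod_def
proof (intro allI impI)
  fix i j assume "j < n"
  then have "T v i j = T (smul d (\<lambda>i j. v i j div d)) i j"
    using assms by (intro local_linear_local) (auto simp: vanishes_mod_def)
  then show "d dvd T v i j" by (simp add: local_linear_smul)
qed

end

section \<open>Composition, powers and differences of local linear operators\<close>

lemma local_linear_id: "local_linear n 0 (\<lambda>v. v)"
  by (auto simp: local_linear_def)

lemma local_linear_comp: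
  assumes T: "local_linear n \<rho> T" and U: "local_linear n \<sigma> U"
  shows "local_linear n (\<rho> + \<sigma>) (\<lambda>v. T (U v))"
  unfolding local_linear_def
proof (intro conjI allI impI)
  fix v :: int_config and j
  assume v: "\<forall>i j. \<bar>i\<bar> \<le> int (\<rho> + \<sigma>) \<longrightarrow> j < n \<longrightarrow> v i j = 0" and j: "j < n"
  show "T (U v) 0 j = 0"
  proof (rule local_linear_local_0[OF T _ j])
    fix i j assume "\<bar>i\<bar> \<le> int \<rho>" "j < n"
    then have "U v i j = U 0 i j"
      using v by (intro local_linear_local[OF U]) auto
    then show "U v i j = 0" by (simp add: local_linear_0[OF U])
  qed
qed (simp_all add: local_linear_add[OF T] local_linear_add[OF U] local_linear_smul[OF T]
  local_linear_smul[OF U] local_linear_shift[OF T] local_linear_shift[OF U])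

lemma local_linear_funpow:
  assumes "local_linear n \<rho> T"
  shows "local_linear n (k * \<rho>) (T ^^ k)"
proof (induction k)
  case 0
  then show ?case using local_linear_id by (simp add: id_def)
next
  case (Suc k)
  then show ?case using local_linear_comp[OF assms Suc] by (simp add: comp_def)
qed

lemma local_linear_minus:
  assumes T: "local_linear n \<rho> T" and U: "local_linear n \<sigma> U"
  shows "local_linear n (max \<rho> \<sigma>) (\<lambda>v. T v - U v)"
  unfolding local_linear_def
proof (intro conjI allI impI)
  fix v :: int_config and j
  assume v: "\<forall>i j. \<bar>i\<bar> \<le> int (max \<rho> \<sigma>) \<longrightarrow> j < n \<longrightarrow> v i j = 0" and j: "j < n"
  have "T v 0 j = 0" "U v 0 j = 0"
    using v j by (auto intro: local_linear_local_0[OF T] local_linear_local_0[OF U])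
  then show "(T v - U v) 0 j = 0" by simp
qed (simp_all add: fun_eq_iff local_linear_add[OF T] local_linear_add[OF U] local_linear_smul[OF T]
  local_linear_smul[OF U] local_linear_shift[OF T] local_linear_shift[OF U] algebra_simps)

lemma funpow_commute:
  assumes "\<And>v. f (g v) = g (f v)"
  shows "f ((g ^^ k) v) = (g ^^ k) (f v)"
  by (induction k) (simp_all add: assms)

text \<open>The binomial theorem for commuting operators: Pascal's rule merges the two sums produced
  by one more factor.\<close>

lemma local_linear_funpow_binomial:
  assumes U: "local_linear n \<rho> U" and E: "local_linear n \<sigma> E" and comm: "\<And>v. E (U v) = U (E v)"
  shows "((\<lambda>v. U v + E v) ^^ t) v =
    (\<Sum>i\<le>t. smul (int (t choose i)) ((U ^^ (t - i)) ((E ^^ i) v)))"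
proof (induction t)
  case 0
  then show ?case by (simp add: fun_eq_iff)
next
  case (Suc t)
  define f where "f i = (U ^^ (Suc t - i)) ((E ^^ i) v)" for i
  have U': "U ((U ^^ (t - i)) ((E ^^ i) v)) = f i" if "i \<le> t" for i
    using that by (simp add: f_def Suc_diff_le)
  have E': "E ((U ^^ (t - i)) ((E ^^ i) v)) = f (Suc i)" for i
    using funpow_commute[of E U, where v = "(E ^^ i) v" and k = "t - i"] comm by (simp add: f_def)
  have "((\<lambda>v. U v + E v) ^^ Suc t) v =
      (\<Sum>i\<le>t. smul (int (t choose i)) (f i)) + (\<Sum>i\<le>t. smul (int (t choose i)) (f (Suc i)))"
    unfolding funpow.simps comp_def Suc local_linear_sum[OF U] local_linear_sum[OF E]
      local_linear_smul[OF U] local_linear_smul[OF E] E'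
    by (intro arg_cong2[of _ _ _ _ "(+)"] sum.cong refl) (simp only: U' atMost_iff)
  \<comment> \<open>The additional summand is zero because \<open>t choose Suc t\<close> is.\<close>
  also have "(\<Sum>i\<le>t. smul (int (t choose i)) (f i)) = (\<Sum>i\<le>Suc t. smul (int (t choose i)) (f i))"
    by (simp add: fun_eq_iff)
  also have "\<dots> = f 0 + (\<Sum>i\<le>t. smul (int (t choose Suc i)) (f (Suc i)))"
    by (subst sum.atMost_Suc_shift) (simp add: fun_eq_iff)
  also have "f 0 + (\<Sum>i\<le>t. smul (int (t choose Suc i)) (f (Suc i))) +
      (\<Sum>i\<le>t. smul (int (t choose i)) (f (Suc i))) =
      f 0 + (\<Sum>i\<le>t. smul (int (Suc t choose Suc i)) (f (Suc i)))"
    by (simp add: fun_eq_iff sum_fun_apply algebra_simps flip: sum.distrib)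
  also have "\<dots> = (\<Sum>i\<le>Suc t. smul (int (Suc t choose i)) (f i))"
    by (subst sum.atMost_Suc_shift) (simp add: fun_eq_iff)
  finally show ?case unfolding f_def .
qed

section \<open>Powers on constant configurations\<close>

text \<open>A power of \<open>F\<close> acts on constant configurations through the matrix of its
  values at \<open>0\<close> on the constant unit vectors. Modulo \<open>m\<close> there are
  \<open>m ^ (n * n)\<close> such matrices, so two of the first \<open>m ^ (n * n) + 1\<close>
  powers share one.\<close>

lemma constant_configs_periodic:
  assumes F: "local_linear n r F" and m: "m > 0"
  obtains a b where "a < b" "b \<le> m ^ (n * n)"
    "\<And>u. vanishes_mod n (int m) ((F ^^ b) (\<lambda>i. u) - (F ^^ a) (\<lambda>i. u))"
proof -
  define \<delta> :: "nat \<Rightarrow> int_config" where "\<delta> l = (\<lambda>i j. if j = l then 1 else 0)" for l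
  define S where "S = {..<n} \<times> {..<n}"
  define g where "g k = restrict (\<lambda>(j, l). (F ^^ k) (\<delta> l) 0 j mod int m) S" for k
  have card: "card (S \<rightarrow>\<^sub>E {0..<int m}) = m ^ (n * n)"
    by (simp add: S_def card_PiE)
  have "g ` {..m ^ (n * n)} \<subseteq> S \<rightarrow>\<^sub>E {0..<int m}"
    using m by (auto simp: g_def)
  then have "card (g ` {..m ^ (n * n)}) \<le> m ^ (n * n)"
    unfolding card[symmetric] by (intro card_mono) (auto simp: S_def intro: finite_PiE)
  then have "\<not> inj_on g {..m ^ (n * n)}"
    by (intro pigeonhole) simp
  then obtain a b where ab: "a < b" "b \<le> m ^ (n * n)" "g a = g b"
    by (auto simp: inj_on_def) (metis linorder_neqE_nat)
  define E where "E v = (F ^^ b) v - (F ^^ a) v" for v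
  have E: "local_linear n (max (b * r) (a * r)) E"
    unfolding E_def by (intro local_linear_minus local_linear_funpow F)
  have \<delta>: "int m dvd E (\<delta> l) 0 j" if "j < n" "l < n" for j l
  proof -
    have "g a (j, l) = g b (j, l)" using ab by simp
    then have "(F ^^ b) (\<delta> l) 0 j mod int m = (F ^^ a) (\<delta> l) 0 j mod int m"
      using that by (simp add: g_def S_def)
    then show ?thesis by (simp add: E_def mod_eq_dvd_iff)
  qed
  have "vanishes_mod n (int m) (E (\<lambda>i. u))" for u
    unfolding vanishes_mod_def
  proof (intro allI impI)
    fix i j assume j: "j < n"
    have "E (\<lambda>i. u) i j = E (shift i (\<lambda>i. u)) 0 j"
      by (simp only: local_linear_shift[OF E]) simp
    also have "shift i (\<lambda>i. u) = (\<lambda>i. u)" by (simp add: fun_eq_iff)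
    \<comment> \<open>The constant \<open>u\<close> and its expansion in unit vectors agree on the
      components below \<open>n\<close>, which is what locality asks for.\<close>
    also have "E (\<lambda>i. u) 0 j = E (\<Sum>l<n. smul (u l) (\<delta> l)) 0 j"
      by (rule local_linear_local[OF E _ j])
        (simp add: sum_fun_apply \<delta>_def if_distrib[of "\<lambda>x. _ * x"] sum.delta cong: if_cong)
    also have "\<dots> = (\<Sum>l<n. u l * E (\<delta> l) 0 j)"
      by (simp add: local_linear_sum[OF E] local_linear_smul[OF E] sum_fun_apply)
    also have "int m dvd \<dots>"
      using j \<delta> by (intro dvd_sum dvd_mult) auto
    finally show "int m dvd E (\<lambda>i. u) i j" .
  qed
  then show thesis using that ab by (auto simp: E_def)
qed

section \<open>Iterated differences and nilpotency\<close>

definition diff_op :: "(int \<Rightarrow> 'a::ab_group_add) \<Rightarrow> int \<Rightarrow> 'a" where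
  "diff_op c = shift 1 c - c"

text \<open>Summing \<open>d\<close> away from \<open>s\<close> in both directions gives a discrete
  antiderivative with prescribed value at \<open>s\<close>.\<close>

lemma diff_op_surj:
  fixes d :: "int \<Rightarrow> 'a::ab_group_add"
  obtains c where "c s = w" "diff_op c = d"
proof -
  define c where "c i = w + (if s \<le> i then \<Sum>t\<in>{s..<i}. d t else - (\<Sum>t\<in>{i..<s}. d t))" for i
  have "diff_op c i = d i" for i
  proof -
    consider "s \<le> i" | "i + 1 = s" | "i + 1 < s" by linarith
    then show "diff_op c i = d i"
    proof cases
      case 1
      then have "{s..<i + 1} = insert i {s..<i}" by auto
      with 1 show ?thesis by (simp add: diff_op_def c_def)
    next
      case 2
      then have "{i..<s} = {i}" by auto
      with 2 show ?thesis by (auto simp add: diff_op_def c_def)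
    next
      case 3
      then have "{i..<s} = insert i {i + 1..<s}" by auto
      with 3 show ?thesis by (simp add: diff_op_def c_def)
    qed
  qed
  then show thesis by (intro that[of c]) (auto simp: c_def)
qed

text \<open>The solutions of \<open>(diff_op ^^ k) c = 0\<close> play the role of polynomials of
  degree below \<open>k\<close>. The induction interpolates the differences of \<open>w\<close> and
  sums them up from the value \<open>w s\<close>.\<close>

lemma polynomial_interpolation:
  fixes w :: "int \<Rightarrow> 'a::ab_group_add"
  shows "\<exists>c. (\<forall>i. s \<le> i \<longrightarrow> i < s + int k \<longrightarrow> c i = w i) \<and> (diff_op ^^ k) c = 0"
proof (induction k arbitrary: w)
  case 0
  show ?case by (intro exI[of _ 0]) simp
next
  case (Suc k)
  obtain d where d: "\<And>i. s \<le> i \<Longrightarrow> i < s + int k \<Longrightarrow> d i = diff_op w i" "(diff_op ^^ k) d = 0"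
    using Suc[of "diff_op w"] by blast
  obtain c where c: "c s = w s" "diff_op c = d" by (rule diff_op_surj)
  have "i < s + int (Suc k) \<longrightarrow> c i = w i" if "s \<le> i" for i
    using that
  proof (induction i rule: int_ge_induct)
    case (step i)
    show ?case
    proof
      assume *: "i + 1 < s + int (Suc k)"
      then have "diff_op c i = diff_op w i" using c d step by simp
      then show "c (i + 1) = w (i + 1)" using step * by (simp add: diff_op_def)
    qed
  qed (simp add: c)
  moreover have "(diff_op ^^ Suc k) c = 0"
    by (simp only: funpow_Suc_right comp_def c d)
  ultimately show ?case by blast
qed

text \<open>If the difference of order \<open>Suc k\<close> is zero modulo \<open>d\<close>, that of
  order \<open>k\<close> is constant modulo \<open>d\<close> and hence killed by \<open>E\<close>.
  As \<open>E\<close> commutes with \<open>diff_op\<close>, each application of \<open>E\<close>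
  lowers by one the order of the vanishing difference.\<close>

lemma kills_constants_funpow:
  assumes E: "local_linear n \<rho> E" and const: "\<And>u. vanishes_mod n d (E (\<lambda>i. u))"
  shows "vanishes_mod n d ((diff_op ^^ k) c) \<Longrightarrow> vanishes_mod n d ((E ^^ k) c)"
proof (induction k arbitrary: c)
  case 0
  then show ?case by simp
next
  case (Suc k)
  define g where "g = (diff_op ^^ k) c"
  have step: "d dvd g (i + 1) j - g i j" if "j < n" for i j
    using Suc.prems that by (simp add: g_def[symmetric]) (simp add: vanishes_mod_def diff_op_def)
  have "d dvd g i j - g 0 j" if "j < n" for i j
  proof (induction i rule: int_induct[of _ 0])
    case (step1 i)
    then show ?case using dvd_add[OF step[OF that, of i] step1(2)] by simp
  next
    case (step2 i)
    then show ?case using dvd_diff[OF step2(2) step[OF that, of "i - 1"]] by simp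
  qed simp
  then have "vanishes_mod n d (E (g - (\<lambda>i. g 0)))"
    by (intro local_linear_vanishes_mod[OF E]) (simp add: vanishes_mod_def)
  then have "vanishes_mod n d (E g)"
    using vanishes_mod_add[OF _ const[of "g 0"]] by (fastforce simp: local_linear_diff[OF E])
  moreover have "E (diff_op v) = diff_op (E v)" for v
    by (simp add: diff_op_def local_linear_diff[OF E] local_linear_shift[OF E])
  then have "E g = (diff_op ^^ k) (E c)"
    unfolding g_def by (rule funpow_commute)
  ultimately have "vanishes_mod n d ((E ^^ k) (E c))"
    using Suc.IH by simp
  then show ?case by (simp add: funpow_swap1)
qed

text \<open>The window of radius \<open>D\<close> has \<open>2 * D + 1\<close> positions, so every
  configuration agrees there with some \<open>c\<close> whose difference of that order is zero. The
  power of \<open>E\<close> of the same order kills \<open>c\<close> and, by the bounded radius,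
  does not distinguish the two at position \<open>0\<close>.\<close>

lemma nilpotent_mod_if_bounded_radius:
  assumes E: "local_linear n \<rho> E" and const: "\<And>u. vanishes_mod n d (E (\<lambda>i. u))"
    and bounded: "\<And>k v j. (\<And>i j. \<bar>i\<bar> \<le> int D \<Longrightarrow> j < n \<Longrightarrow> v i j = 0) \<Longrightarrow> j < n \<Longrightarrow>
      d dvd (E ^^ k) v 0 j"
  shows "vanishes_mod n d ((E ^^ (2 * D + 1)) v)"
  unfolding vanishes_mod_def
proof (intro allI impI)
  fix i j assume j: "j < n"
  define k where "k = 2 * D + 1"
  note Ek = local_linear_funpow[OF E, of k]
  obtain c where c: "\<And>i'. - int D \<le> i' \<Longrightarrow> i' < - int D + int k \<Longrightarrow> c i' = shift i v i'"
    "(diff_op ^^ k) c = 0"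
    using polynomial_interpolation[of "- int D" k "shift i v"] by blast
  have "d dvd (E ^^ k) (shift i v - c) 0 j"
    using c(1) j by (intro bounded) (auto simp: k_def)
  moreover have "d dvd (E ^^ k) c 0 j"
    using kills_constants_funpow[OF E, of d k c, OF const] j by (simp add: c(2) vanishes_mod_def)
  ultimately have "d dvd (E ^^ k) (shift i v) 0 j"
    using dvd_add[of d "(E ^^ k) (shift i v - c) 0 j" "(E ^^ k) c 0 j"]
    by (simp add: local_linear_diff[OF Ek])
  then show "d dvd (E ^^ (2 * D + 1)) v i j"
    by (simp only: local_linear_shift[OF Ek]) (simp add: k_def)
qed

text \<open>Modulo \<open>d\<close> every power of \<open>F\<close> agrees with one of exponent
  below \<open>b'\<close>, and \<open>E ^^ k\<close> is an integer combination of powers of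
  \<open>F\<close>. The extra factor \<open>F ^^ s\<close> makes the induction on \<open>k\<close>
  go through.\<close>

lemma bounded_radius_if_periodic:
  assumes F: "local_linear n r F" and "a' < b'" and E: "E = (\<lambda>v. (F ^^ b) v - (F ^^ a) v)"
    and periodic: "\<And>v. vanishes_mod n d ((F ^^ b') v - (F ^^ a') v)"
    and v: "\<And>i j. \<bar>i\<bar> \<le> int (b' * r) \<Longrightarrow> j < n \<Longrightarrow> v i j = 0" and j: "j < n"
  shows "d dvd (F ^^ s) ((E ^^ k) v) 0 j"
proof -
  \<comment> \<open>As long as the exponent is at least \<open>b'\<close>, trading \<open>b'\<close>
    steps for \<open>a'\<close> steps lowers it.\<close>
  have red: "\<exists>s'<b'. vanishes_mod n d ((F ^^ s) v - (F ^^ s') v)" for s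
  proof (induction s rule: less_induct)
    case (less s)
    show ?case
    proof (cases "s < b'")
      case False
      then have s: "s = (s - b') + b'" by simp
      have "vanishes_mod n d ((F ^^ (s - b')) ((F ^^ b') v - (F ^^ a') v))"
        by (intro local_linear_vanishes_mod[OF local_linear_funpow[OF F]] periodic)
      then have *: "vanishes_mod n d ((F ^^ s) v - (F ^^ (s - b' + a')) v)"
        by (subst s) (simp add: funpow_add local_linear_diff[OF local_linear_funpow[OF F]])
      have "s - b' + a' < s" using False \<open>a' < b'\<close> by simp
      then obtain s' where "s' < b'" "vanishes_mod n d ((F ^^ (s - b' + a')) v - (F ^^ s') v)"
        using less by blast
      then show ?thesis using * vanishes_mod_diff_trans by blast
    qed (use vanishes_mod_0 in \<open>force intro!: exI[of _ s] simp del: zero_fun_apply\<close>)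
  qed
  have base: "d dvd (F ^^ s) v 0 j" for s
  proof -
    obtain s' where s': "s' < b'" "vanishes_mod n d ((F ^^ s) v - (F ^^ s') v)"
      using red by blast
    have "s' * r \<le> b' * r" using s' by simp
    then have "(F ^^ s') v 0 j = 0"
      by (intro local_linear_local_0[OF local_linear_funpow[OF F] _ j] v) linarith+
    moreover have "d dvd ((F ^^ s) v - (F ^^ s') v) 0 j"
      using s' j by (simp only: vanishes_mod_def)
    ultimately show ?thesis by simp
  qed
  show ?thesis
  proof (induction k arbitrary: s)
    case 0
    then show ?case by (simp add: base)
  next
    case (Suc k)
    have "d dvd (F ^^ (s + b)) ((E ^^ k) v) 0 j - (F ^^ (s + a)) ((E ^^ k) v) 0 j"
      by (intro dvd_diff Suc)
    moreover have "(E ^^ Suc k) v = (F ^^ b) ((E ^^ k) v) - (F ^^ a) ((E ^^ k) v)"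
      by (simp only: funpow.simps comp_def) (simp only: E)
    then have "(F ^^ s) ((E ^^ Suc k) v) = (F ^^ (s + b)) ((E ^^ k) v) - (F ^^ (s + a)) ((E ^^ k) v)"
      by (simp only: local_linear_diff[OF local_linear_funpow[OF F]] funpow_add comp_def)
    ultimately show ?case by simp
  qed
qed

section \<open>The nilpotency index modulo a prime and modulo \<open>m\<close>\<close>

text \<open>Modulo \<open>p\<close> a nonzero polynomial in the shift annihilates \<open>w\<close>,
  whose support is bounded to the right. There are no zero divisors modulo a prime, so the lowest
  coefficient times the rightmost nonzero value of \<open>w\<close> could not vanish.\<close>

lemma vanishes_mod_prime_cancel:
  fixes p :: int
  assumes p: "prime p" and supp: "\<And>i j. i > B \<Longrightarrow> j < n \<Longrightarrow> w i j = 0"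
    and e: "s < L" "\<not> p dvd e s"
    and rel: "\<And>x j. j < n \<Longrightarrow> p dvd (\<Sum>t<L. e t * w (x + int t) j)"
  shows "vanishes_mod n p w"
proof (rule ccontr)
  assume "\<not> ?thesis"
  then obtain i0 j0 where 0: "j0 < n" "\<not> p dvd w i0 j0" by (auto simp: vanishes_mod_def)
  define I where "I = {i \<in> {i0..B}. \<exists>j<n. \<not> p dvd w i j}"
  have "i0 \<le> B" using supp[of i0 j0] 0 by (cases "i0 \<le> B") auto
  then have I: "finite I" "i0 \<in> I" using 0 by (auto simp: I_def intro: finite_subset[of _ "{i0..B}"])
  define i where "i = Max I"
  have "i \<in> I" using I by (auto simp: i_def intro!: Max_in)
  then obtain j where j: "j < n" "\<not> p dvd w i j" by (auto simp: I_def)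
  have above: "p dvd w i' j" if "i' > i" for i'
  proof (rule ccontr)
    assume "\<not> ?thesis"
    moreover from this have "i' \<le> B" using supp[of i' j] j by (cases "i' \<le> B") auto
    ultimately have "i' \<in> I" using that j \<open>i \<in> I\<close> by (auto simp: I_def)
    then show False using I(1) that Max_ge leD unfolding i_def by blast
  qed
  define s0 where "s0 = (LEAST s. \<not> p dvd e s)"
  have s0: "\<not> p dvd e s0" unfolding s0_def by (rule LeastI) (rule e)
  have "s0 \<le> s" unfolding s0_def by (rule Least_le) (rule e)
  have below: "p dvd e t" if "t < s0" for t
    using that not_less_Least unfolding s0_def by blast
  \<comment> \<open>At position \<open>i - int s0\<close>, the terms before \<open>s0\<close> have
    coefficients divisible by \<open>p\<close> and those after \<open>s0\<close> read
    \<open>w\<close> beyond \<open>i\<close>; only the product of the two extreme values is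
    left.\<close>
  have "p dvd (\<Sum>t<L. e t * w (i - int s0 + int t) j)" by (rule rel) fact
  also have "(\<Sum>t<L. e t * w (i - int s0 + int t) j) =
      e s0 * w i j + (\<Sum>t\<in>{..<L} - {s0}. e t * w (i - int s0 + int t) j)"
    using \<open>s0 \<le> s\<close> \<open>s < L\<close> by (subst sum.remove[of _ s0]) auto
  finally have "p dvd e s0 * w i j"
  proof (subst (asm) dvd_add_left_iff)
    show "p dvd (\<Sum>t\<in>{..<L} - {s0}. e t * w (i - int s0 + int t) j)"
    proof (rule dvd_sum)
      fix t assume "t \<in> {..<L} - {s0}"
      then consider "t < s0" | "t > s0" by fastforce
      then show "p dvd e t * w (i - int s0 + int t) j"
      proof cases
        case 1
        then show ?thesis by (intro dvd_mult2 below)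
      next
        case 2
        then show ?thesis by (intro dvd_mult above) simp
      qed
    qed
  qed
  then show False using p s0 j by (simp add: prime_dvd_mult_iff)
qed

text \<open>
  Siegel's lemma: there are more polynomial coefficient vectors of degree less than \<open>L\<close> than values of
  the combination, as \<open>n + 1\<close> coefficients face only \<open>n\<close> components.
\<close>

lemma siegel_relation:
  fixes p :: nat and u :: "nat \<Rightarrow> int_config"
  assumes p: "prime p" and supp: "\<And>i x j. i \<le> n \<Longrightarrow> \<bar>x\<bar> > int C \<Longrightarrow> j < n \<Longrightarrow> u i x j = 0"
  obtains L e i s where "i \<le> n" "s < L" "\<not> int p dvd e i s"
    "\<And>x j. j < n \<Longrightarrow> int p dvd (\<Sum>i\<le>n. \<Sum>t<L. e i t * u i (x + int t) j)"
proof -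
  \<comment> \<open>This length is the least for which \<open>Suc n * L\<close> coefficients
    outnumber the \<open>n * (2 * C + L + 1)\<close> entries on \<open>W\<close>.\<close>
  define L where "L = n * (2 * C + 1) + 1"
  define S where "S = {..n} \<times> {..<L}"
  \<comment> \<open>From positions outside this range, shifts by less than \<open>L\<close> meet
    only zeros.\<close>
  define W where "W = {- int (C + L)..<int C + 1} \<times> {..<n}"
  define A where "A = (S \<rightarrow>\<^sub>E {0..<int p})"
  define h where "h e = (\<lambda>(x, j). \<Sum>i\<le>n. \<Sum>t<L. e (i, t) * u i (x + int t) j)" for e :: "nat \<times> nat \<Rightarrow> int"
  define g where "g e = restrict (\<lambda>y. h e y mod int p) W" for e
  have "p > 1" using p by (rule prime_gt_1_nat)
  have width: "nat (int C * 2 + (1 + int L)) = C * 2 + L + 1" by simp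
  have "g ` A \<subseteq> W \<rightarrow>\<^sub>E {0..<int p}"
    using \<open>p > 1\<close> by (auto simp only: g_def restrict_PiE_iff) simp_all
  then have "card (g ` A) \<le> card (W \<rightarrow>\<^sub>E {0..<int p})"
    by (intro card_mono) (simp_all add: W_def finite_PiE)
  also have "\<dots> = p ^ (n * (2 * C + L + 1))"
    by (simp add: W_def card_PiE mult.commute width)
  also have "\<dots> < p ^ (Suc n * L)"
    using \<open>p > 1\<close> by (intro power_strict_increasing) (auto simp: L_def algebra_simps)
  also have "\<dots> = card A"
    by (simp add: A_def S_def card_PiE mult.commute)
  finally have "\<not> inj_on g A" by (rule pigeonhole)
  then obtain e1 e2 where e12: "e1 \<in> A" "e2 \<in> A" "g e1 = g e2" "e1 \<noteq> e2"
    by (auto simp: inj_on_def)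
  then obtain i s where ies: "(i, s) \<in> S" "e1 (i, s) \<noteq> e2 (i, s)"
    unfolding A_def by (metis PiE_ext surj_pair)
  define e where "e i t = e1 (i, t) - e2 (i, t)" for i t
  show thesis
  proof (rule that[of i s L e])
    show "i \<le> n" "s < L" using ies by (auto simp: S_def)
    have "e1 (i, s) \<in> {0..<int p}" "e2 (i, s) \<in> {0..<int p}"
      using e12 ies by (auto simp: A_def)
    \<comment> \<open>Distinct residues in \<open>{0..<int p}\<close> differ by less than
      \<open>p\<close>, so their difference is not a multiple of \<open>p\<close>.\<close>
    then have "\<bar>e i s\<bar> < int p" "e i s \<noteq> 0" using ies by (auto simp: e_def)
    then show "\<not> int p dvd e i s" using dvd_imp_le_int[of "e i s" "int p"] by auto
  next
    fix x j assume j: "j < n"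
    show "int p dvd (\<Sum>i\<le>n. \<Sum>t<L. e i t * u i (x + int t) j)"
    proof (cases "(x, j) \<in> W")
      case True
      have "g e1 (x, j) = g e2 (x, j)" using e12 by simp
      then have "int p dvd h e1 (x, j) - h e2 (x, j)"
        using True by (simp add: g_def mod_eq_dvd_iff)
      then show ?thesis by (simp add: h_def e_def left_diff_distrib sum_subtractf)
    next
      case False
      then have "u i (x + int t) j = 0" if "i \<le> n" "t < L" for i t
        using j that by (intro supp) (auto simp: W_def)
      then show ?thesis by simp
    qed
  qed
qed

text \<open>For \<open>v\<close> of bounded support, a relation between the iterates up to
  \<open>(E ^^ n) v\<close> takes the place of the Cayley-Hamilton theorem. If the least
  \<open>k\<close> with \<open>(E ^^ k) v\<close> zero modulo \<open>p\<close> exceeded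
  \<open>n\<close>, a power of \<open>E\<close> would reduce the relation to its lowest term, and
  cancellation would make \<open>(E ^^ (k - 1)) v\<close> zero as well.\<close>

lemma nilpotency_index_prime:
  fixes p :: nat
  assumes p: "prime p" and E: "local_linear n \<rho> E"
    and nil: "\<And>v. vanishes_mod n (int p) ((E ^^ K) v)"
  shows "vanishes_mod n (int p) ((E ^^ n) v)"
proof -
  have fin: "vanishes_mod n (int p) ((E ^^ n) v)"
    if v: "\<And>x j. \<bar>x\<bar> > int C \<Longrightarrow> j < n \<Longrightarrow> v x j = 0" for v C
  proof -
    define k where "k = (LEAST k. vanishes_mod n (int p) ((E ^^ k) v))"
    have k: "vanishes_mod n (int p) ((E ^^ k) v)"
      unfolding k_def by (rule LeastI) (rule nil)
    have ge_k: "vanishes_mod n (int p) ((E ^^ l) v)" if "k \<le> l" for l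
    proof -
      have "(E ^^ l) v = (E ^^ (l - k)) ((E ^^ k) v)"
        using that by (metis comp_apply funpow_add le_add_diff_inverse2)
      then show ?thesis
        by (simp add: local_linear_vanishes_mod[OF local_linear_funpow[OF E] k])
    qed
    have supp: "(E ^^ i) v x j = 0" if "i \<le> l" "\<bar>x\<bar> > int (C + l * \<rho>)" "j < n" for i x j l
    proof -
      have "i * \<rho> \<le> l * \<rho>" using \<open>i \<le> l\<close> by simp
      have "(E ^^ i) v x j = (E ^^ i) 0 x j"
      proof (rule local_linear_local[OF local_linear_funpow[OF E]])
        fix i' j assume "\<bar>i' - x\<bar> \<le> int (i * \<rho>)" "j < n"
        moreover have "int (i * \<rho>) \<le> int (l * \<rho>)" using \<open>i * \<rho> \<le> l * \<rho>\<close> by linarith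
        ultimately have "v i' j = 0"
          using \<open>\<bar>x\<bar> > int (C + l * \<rho>)\<close> by (intro v) (simp only: of_nat_add, linarith)
        then show "v i' j = 0 i' j" by simp
      qed fact
      then show ?thesis by (simp add: local_linear_0[OF local_linear_funpow[OF E]])
    qed
    have "k \<le> n"
    proof (rule ccontr)
      assume "\<not> k \<le> n"
      obtain L e i s where e: "i \<le> n" "s < L" "\<not> int p dvd e i s" and
        rel: "\<And>x j. j < n \<Longrightarrow> int p dvd (\<Sum>i\<le>n. \<Sum>t<L. e i t * (E ^^ i) v (x + int t) j)"
        by (rule siegel_relation[OF p, where n = n and C = "C + n * \<rho>" and u = "\<lambda>i. (E ^^ i) v",
              OF supp[where l = n]]) (assumption | rule that)+
      define i0 where "i0 = (LEAST i. \<exists>s<L. \<not> int p dvd e i s)"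
      have "\<exists>s<L. \<not> int p dvd e i0 s"
        unfolding i0_def by (rule LeastI) (use e in auto)
      then obtain s0 where s0: "s0 < L" "\<not> int p dvd e i0 s0" by blast
      have "i0 \<le> i" unfolding i0_def by (rule Least_le) (use e in auto)
      then have "i0 \<le> n" using e by simp
      have below: "int p dvd e i' t" if "i' < i0" "t < L" for i' t
        using that not_less_Least unfolding i0_def by blast
      \<comment> \<open>Applying \<open>E ^^ q\<close> carries the lowest term \<open>i0\<close> to
        the last iterate that does not vanish and all higher terms to vanishing ones.\<close>
      define q where "q = k - 1 - i0"
      define w where "w = (E ^^ (k - 1)) v"
      have q: "q + i0 = k - 1" using \<open>\<not> k \<le> n\<close> \<open>i0 \<le> n\<close> by (simp add: q_def)
      note Eq = local_linear_funpow[OF E, of q]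
      define R where "R = (\<Sum>i\<le>n. \<Sum>t<L. smul (e i t) (shift (int t) ((E ^^ i) v)))"
      have "vanishes_mod n (int p) R"
        using rel by (simp add: vanishes_mod_def R_def sum_fun_apply)
      then have "vanishes_mod n (int p) ((E ^^ q) R)"
        by (rule local_linear_vanishes_mod[OF Eq])
      also have "(E ^^ q) R = (\<Sum>i\<le>n. \<Sum>t<L. smul (e i t) (shift (int t) ((E ^^ (q + i)) v)))"
        by (simp add: R_def local_linear_sum[OF Eq] local_linear_smul[OF Eq]
            local_linear_shift[OF Eq] funpow_add)
      also have "\<dots> = (\<Sum>t<L. smul (e i0 t) (shift (int t) w)) +
          (\<Sum>i\<in>{..n} - {i0}. \<Sum>t<L. smul (e i t) (shift (int t) ((E ^^ (q + i)) v)))"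
        using \<open>i0 \<le> n\<close> by (subst sum.remove[of _ i0]) (simp_all add: q w_def)
      finally have *: "vanishes_mod n (int p) \<dots>" .
      have rest: "vanishes_mod n (int p)
          (\<Sum>i\<in>{..n} - {i0}. \<Sum>t<L. smul (e i t) (shift (int t) ((E ^^ (q + i)) v)))"
      proof (intro vanishes_mod_sum)
        fix i t assume i: "i \<in> {..n} - {i0}" and t: "t \<in> {..<L}"
        show "vanishes_mod n (int p) (smul (e i t) (shift (int t) ((E ^^ (q + i)) v)))"
        proof (cases "i < i0")
          case True
          then show ?thesis using below[of i t] t by (simp add: vanishes_mod_def)
        next
          case False
          then have "k \<le> q + i" using i q by (cases "i = i0") auto
          then show ?thesis using ge_k[of "q + i"] by (auto simp: vanishes_mod_def)
        qed
      qed
      have "vanishes_mod n (int p) (\<Sum>t<L. smul (e i0 t) (shift (int t) w))"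
        using vanishes_mod_diff[OF * rest] by (simp only: add_diff_cancel_right')
      then have "int p dvd (\<Sum>t<L. e i0 t * w (x + int t) j)" if "j < n" for x j
        using that by (simp add: vanishes_mod_def sum_fun_apply)
      then have "vanishes_mod n (int p) w"
        using p s0 supp[where i = "k - 1" and l = "k - 1"]
        by (intro vanishes_mod_prime_cancel[where B = "int (C + (k - 1) * \<rho>)" and s = s0 and e = "e i0"])
          (auto simp: w_def)
      then have "k \<le> k - 1" unfolding w_def by (subst k_def) (rule Least_le)
      then show False using \<open>\<not> k \<le> n\<close> by simp
    qed
    then show ?thesis by (rule ge_k)
  qed
  note En = local_linear_funpow[OF E, of n]
  show ?thesis
    unfolding vanishes_mod_def
  proof (intro allI impI)
    fix i j assume j: "j < n"
    \<comment> \<open>Cutting off outside the radius of \<open>E ^^ n\<close> keeps the value at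
      \<open>0\<close> and reduces the claim to bounded support.\<close>
    define w :: int_config where "w x = (if \<bar>x\<bar> \<le> int (n * \<rho>) then v (x + i) else 0)" for x
    have "(E ^^ n) v i j = (E ^^ n) (shift i v) 0 j"
      by (simp add: local_linear_shift[OF En])
    also have "\<dots> = (E ^^ n) w 0 j"
      by (rule local_linear_local[OF En _ j]) (simp add: w_def)
    also have "int p dvd \<dots>"
      using fin[of "n * \<rho>" w] j by (simp add: w_def vanishes_mod_def)
    finally show "int p dvd (E ^^ n) v i j" .
  qed
qed

text \<open>Induction over the divisors \<open>d = p * d'\<close> of \<open>m\<close>: the first
  \<open>n * d'\<close> applications of \<open>E\<close> produce the factor \<open>d'\<close>, the
  next \<open>n\<close> produce the factor \<open>p\<close>, and \<open>n * d' + n\<close> is at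
  most \<open>n * d\<close>.\<close>

lemma nilpotency_index:
  fixes m :: nat
  assumes E: "local_linear n \<rho> E" and "m > 0"
    and nil: "\<And>v. vanishes_mod n (int m) ((E ^^ K) v)"
  shows "vanishes_mod n (int m) ((E ^^ (n * m)) v)"
proof -
  have "d dvd m \<Longrightarrow> vanishes_mod n (int d) ((E ^^ (n * d)) v)" for d v
  proof (induction d rule: less_induct)
    case (less d)
    have "d > 0" using less.prems \<open>m > 0\<close> by (rule dvd_pos_nat[rotated])
    show ?case
    proof (cases "d = 1")
      case True
      then show ?thesis by (simp add: vanishes_mod_def)
    next
      case False
      then obtain p where p: "prime p" "p dvd d" using prime_factor_nat by blast
      then obtain d' where d: "d = p * d'" by auto
      have "d' > 0" using d \<open>d > 0\<close> by auto
      have "d' < d" using d \<open>d' > 0\<close> prime_gt_1_nat[OF p(1)] by simp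
      moreover have "d' dvd m" using less.prems d dvd_mult_right by blast
      ultimately have IH: "vanishes_mod n (int d') ((E ^^ (n * d')) v)" by (rule less.IH)
      define c :: int_config where "c i j = (E ^^ (n * d')) v i j div int d'" for i j
      have c: "smul (int d') c i j = (E ^^ (n * d')) v i j" if "j < n" for i j
        using IH that by (simp add: vanishes_mod_def c_def)
      have nil_p: "vanishes_mod n (int p) ((E ^^ K) u)" for u
        using vanishes_mod_dvd[OF _ nil] p less.prems by (meson dvd_trans int_dvd_int_iff)
      have "d' + 1 \<le> d" using \<open>d' < d\<close> by simp
      then have "n * d = (n * d - n * (d' + 1)) + (n + n * d')"
        by (metis add.commute le_add_diff_inverse2 mult.right_neutral mult_le_mono2 distrib_left)
      then have "(E ^^ (n * d)) v = (E ^^ (n * d - n * (d' + 1))) ((E ^^ n) ((E ^^ (n * d')) v))"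
        by (metis comp_apply funpow_add)
      moreover have "vanishes_mod n (int d) ((E ^^ n) ((E ^^ (n * d')) v))"
        unfolding vanishes_mod_def
      proof (intro allI impI)
        fix i j assume j: "j < n"
        have "(E ^^ n) ((E ^^ (n * d')) v) i j = (E ^^ n) (smul (int d') c) i j"
          by (rule local_linear_local[OF local_linear_funpow[OF E] _ j]) (simp add: c del: smul_apply)
        also have "\<dots> = int d' * (E ^^ n) c i j"
          by (simp add: local_linear_smul[OF local_linear_funpow[OF E]])
        also have "int d dvd \<dots>"
          using nilpotency_index_prime[OF p(1) E nil_p, of c] j
          by (simp add: vanishes_mod_def d mult.commute mult_dvd_mono)
        finally show "int d dvd (E ^^ n) ((E ^^ (n * d')) v) i j" .
      qed
      ultimately show ?thesis
        by (simp add: local_linear_vanishes_mod[OF local_linear_funpow[OF E]])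
    qed
  qed
  then show ?thesis by simp
qed

section \<open>A computable exponent at which the powers coincide\<close>

text \<open>In \<open>i * (t choose i) = t * ((t - 1) choose (i - 1))\<close> the number
  \<open>t\<close> is a multiple of \<open>m * i\<close>, so \<open>i\<close> cancels and leaves the
  factor \<open>m\<close>.\<close>

lemma dvd_choose_if_fact_dvd:
  assumes "m * fact K dvd t" "0 < i" "i \<le> K"
  shows "m dvd t choose i"
proof (cases "t = 0")
  case False
  have "i dvd fact K" using assms by (simp add: dvd_fact)
  then obtain q where q: "fact K = i * q" by auto
  obtain s where "t = m * fact K * s" using assms by auto
  then have t: "t = i * (m * q * s)" by (simp add: q)
  obtain t' i' where *: "t = Suc t'" "i = Suc i'" using False assms by (metis gr0_conv_Suc not_gr0)
  have "i * (t choose i) = t * (t' choose i')"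
    unfolding * by (rule Suc_times_binomial_eq[symmetric, unfolded mult.commute[of "_ choose _"]])
  then have "t choose i = m * (q * s * (t' choose i'))" using assms t by simp
  then show ?thesis by simp
qed (use assms in \<open>auto simp: binomial_eq_0\<close>)

text \<open>The exponents \<open>a'\<close> and \<open>b'\<close> supply the bounded radius that
  makes \<open>E\<close> nilpotent, but do not enter \<open>N\<close>. Modulo \<open>m\<close> the
  powers from exponent \<open>a * t\<close> on have period \<open>(b - a) * t\<close>, which divides
  \<open>N\<close>.\<close>

lemma finitely_many_powers_bound:
  fixes m :: nat
  assumes F: "local_linear n r F" and "m > 0" and "a' < b'"
    and periodic: "\<And>v. vanishes_mod n (int m) ((F ^^ b') v - (F ^^ a') v)"
    and N: "N = m * fact (n * m) * fact (m ^ (n * n))"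
  shows "vanishes_mod n (int m) ((F ^^ N) v - (F ^^ (2 * N)) v)"
proof -
  obtain a b where ab: "a < b" "b \<le> m ^ (n * n)"
    and const: "\<And>u. vanishes_mod n (int m) ((F ^^ b) (\<lambda>i. u) - (F ^^ a) (\<lambda>i. u))"
    using constant_configs_periodic[OF F \<open>m > 0\<close>] by blast
  define E where "E = (\<lambda>v. (F ^^ b) v - (F ^^ a) v)"
  have E: "local_linear n (max (b * r) (a * r)) E"
    unfolding E_def by (intro local_linear_minus local_linear_funpow F)
  have "vanishes_mod n (int m) ((E ^^ (2 * (b' * r) + 1)) v)" for v
  proof (rule nilpotent_mod_if_bounded_radius[OF E])
    show "vanishes_mod n (int m) (E (\<lambda>i. u))" for u
      unfolding E_def by (rule const)
    show "int m dvd (E ^^ k) v 0 j"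
      if "\<And>i j. \<bar>i\<bar> \<le> int (b' * r) \<Longrightarrow> j < n \<Longrightarrow> v i j = 0" "j < n" for k v j
      using bounded_radius_if_periodic[OF F \<open>a' < b'\<close> E_def periodic that, where s = 0 and k = k] by simp
  qed
  then have nil: "vanishes_mod n (int m) ((E ^^ (n * m)) v)" for v
    by (rule nilpotency_index[OF E \<open>m > 0\<close>])
  define t where "t = m * fact (n * m)"
  note Fa = local_linear_funpow[OF F, of a]
  have step: "vanishes_mod n (int m) ((F ^^ (b * t)) v - (F ^^ (a * t)) v)" for v
  proof -
    have comm: "E ((F ^^ a) v) = (F ^^ a) (E v)" for v
      unfolding E_def local_linear_diff[OF Fa]
      by (simp only: add.commute flip: funpow_add[unfolded fun_eq_iff comp_def, rule_format])
    have "(F ^^ b) = (\<lambda>v. (F ^^ a) v + E v)"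
      by (rule ext) (simp only: E_def add_diff_eq add_diff_cancel_left')
    then have "(F ^^ (b * t)) v = ((\<lambda>v. (F ^^ a) v + E v) ^^ t) v"
      by (simp only: flip: funpow_mult)
    also have "\<dots> = (\<Sum>i\<le>t. smul (int (t choose i)) (((F ^^ a) ^^ (t - i)) ((E ^^ i) v)))"
      by (rule local_linear_funpow_binomial[OF Fa E comm])
    also have "\<dots> = (F ^^ (a * t)) v +
        (\<Sum>i\<in>{..t} - {0}. smul (int (t choose i)) (((F ^^ a) ^^ (t - i)) ((E ^^ i) v)))"
      by (subst sum.remove[of _ 0]) (simp_all add: funpow_mult fun_eq_iff)
    finally have eq: "(F ^^ (b * t)) v - (F ^^ (a * t)) v =
        (\<Sum>i\<in>{..t} - {0}. smul (int (t choose i)) (((F ^^ a) ^^ (t - i)) ((E ^^ i) v)))"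
      by (simp only: add_diff_cancel_left')
    show ?thesis
      unfolding eq
    proof (rule vanishes_mod_sum)
      fix i assume i: "i \<in> {..t} - {0}"
      show "vanishes_mod n (int m) (smul (int (t choose i)) (((F ^^ a) ^^ (t - i)) ((E ^^ i) v)))"
      \<comment> \<open>Up to \<open>n * m\<close> the binomial coefficients are multiples of
        \<open>m\<close> by the choice of \<open>t\<close>; beyond it the power of \<open>E\<close>
        is zero modulo \<open>m\<close>.\<close>
      proof (cases "i \<le> n * m")
        case True
        then have "int m dvd int (t choose i)"
          using i dvd_choose_if_fact_dvd[of m "n * m" t i] by (simp add: t_def)
        then show ?thesis by (simp add: vanishes_mod_def)
      next
        case False
        then have "(E ^^ i) v = (E ^^ (n * m)) ((E ^^ (i - n * m)) v)"
          by (metis comp_apply funpow_add le_add_diff_inverse nle_le)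
        then have "vanishes_mod n (int m) ((E ^^ i) v)" by (simp only: nil)
        then show ?thesis
          by (intro vanishes_mod_smul local_linear_vanishes_mod[OF local_linear_funpow[OF Fa]])
      qed
    qed
  qed
  define P where "P = (b - a) * t"
  have per: "vanishes_mod n (int m) ((F ^^ s) v - (F ^^ (s + k * P)) v)" if "a * t \<le> s" for s k
  proof (induction k)
    case 0
    then show ?case by (simp add: vanishes_mod_def)
  next
    case (Suc k)
    define q where "q = s + k * P - a * t"
    have q: "s + k * P = q + a * t" using that by (simp add: q_def)
    have "a * t + P = b * t" using ab by (simp add: P_def flip: add_mult_distrib)
    then have q': "s + Suc k * P = q + b * t" using q by simp
    have "vanishes_mod n (int m) ((F ^^ q) ((F ^^ (b * t)) v - (F ^^ (a * t)) v))"
      by (intro local_linear_vanishes_mod[OF local_linear_funpow[OF F]] step)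
    then have "vanishes_mod n (int m) ((F ^^ (q + b * t)) v - (F ^^ (q + a * t)) v)"
      by (simp only: local_linear_diff[OF local_linear_funpow[OF F]] funpow_add comp_def)
    then have "vanishes_mod n (int m) ((F ^^ (q + a * t)) v - (F ^^ (q + b * t)) v)"
      by (simp only: vanishes_mod_diff_commute)
    then show ?case
      unfolding q' by (rule vanishes_mod_diff_trans[OF Suc[unfolded q]])
  qed
  have Nt: "N = t * fact (m ^ (n * n))" by (simp add: N t_def)
  \<comment> \<open>As \<open>b \<le> m ^ (n * n)\<close>, the factorial is a multiple of
    \<open>b - a\<close> and at least \<open>a\<close>. Thus \<open>N\<close> is a multiple of the
    period and not below \<open>a * t\<close>.\<close>
  have "b - a dvd fact (m ^ (n * n))" using ab by (intro dvd_fact) auto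
  then obtain k where "fact (m ^ (n * n)) = (b - a) * k" by auto
  then have k: "N = k * P" by (simp add: Nt P_def)
  have "a \<le> fact (m ^ (n * n))" using ab fact_ge_self[of "m ^ (n * n)"] by linarith
  then have "a * t \<le> N" by (simp add: Nt mult.commute)
  from per[OF this, of k] show ?thesis by (simp flip: k add: mult_2)
qed

section \<open>Recursive functions\<close>

text \<open>
  The elements of \<open>X\<close> are the variables, viewed as projections from a type of environments; binding a
  new variable extends the environment by a pair.
\<close>

definition recursive_in :: "('e \<Rightarrow> nat) list \<Rightarrow> ('e \<Rightarrow> nat) \<Rightarrow> bool" where
  "recursive_in X f \<longleftrightarrow> (\<exists>p. \<forall>e. computes p (map (\<lambda>x. x e) X) (f e))"

lemma recursive_in_var: "x \<in> set X \<Longrightarrow> recursive_in X x"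
  unfolding recursive_in_def in_set_conv_nth
  by (metis Proj length_map nth_map)

text \<open>Composition of programs as substitution: the variables in \<open>Y\<close>, read in the
  environment \<open>s e\<close>, are the arguments of \<open>f\<close>.\<close>

lemma recursive_in_comp:
  assumes f: "recursive_in Y f" and Y: "\<forall>y\<in>set Y. recursive_in X (\<lambda>e. y (s e))"
  shows "recursive_in X (\<lambda>e. f (s e))"
proof -
  obtain p where p: "\<And>d. computes p (map (\<lambda>y. y d) Y) (f d)"
    using f by (auto simp: recursive_in_def)
  have "\<forall>y\<in>set Y. \<exists>g. \<forall>e. computes g (map (\<lambda>x. x e) X) (y (s e))"
    using Y by (simp add: recursive_in_def)
  then obtain G where G: "\<And>y e. y \<in> set Y \<Longrightarrow> computes (G y) (map (\<lambda>x. x e) X) (y (s e))"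
    by metis
  have "computes (Comp p (map G Y)) (map (\<lambda>x. x e) X) (f (s e))" for e
    by (rule Comp[OF _ _ p]) (simp_all add: G)
  then show ?thesis by (auto simp: recursive_in_def)
qed

lemma recursive_in_comp1:
  assumes "recursive_in [\<lambda>x. x] f" "recursive_in X a"
  shows "recursive_in X (\<lambda>e. f (a e))"
  using recursive_in_comp[OF assms(1), of X a] assms(2) by simp

lemma recursive_in_comp2:
  assumes "recursive_in [fst, snd] (\<lambda>t. f (fst t) (snd t))" "recursive_in X a" "recursive_in X b"
  shows "recursive_in X (\<lambda>e. f (a e) (b e))"
proof -
  have "recursive_in X (\<lambda>e. (\<lambda>t. f (fst t) (snd t)) (a e, b e))"
    by (rule recursive_in_comp[OF assms(1)]) (use assms(2,3) in auto)
  then show ?thesis by simp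
qed

lemma recursive_in_Suc:
  assumes "recursive_in X a"
  shows "recursive_in X (\<lambda>e. Suc (a e))"
proof (rule recursive_in_comp1[OF _ assms])
  show "recursive_in [\<lambda>x. x] Suc"
    unfolding recursive_in_def by (rule exI[of _ Succ]) (simp add: computes.Succ)
qed

lemma recursive_in_const: "recursive_in X (\<lambda>e. k)"
proof (induction k)
  case 0
  show ?case unfolding recursive_in_def by (blast intro: computes.Zero)
qed (rule recursive_in_Suc)

text \<open>The step function lives in environments \<open>(k, y, e)\<close>; counter and previous
  value come first, as in the argument order of \<open>Prec\<close>.\<close>

lemma recursive_in_rec_nat:
  assumes "recursive_in X a" "recursive_in X b"
    "recursive_in ((\<lambda>p. fst p) # (\<lambda>p. fst (snd p)) # map (\<lambda>x p. x (snd (snd p))) X)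
      (\<lambda>p. g (snd (snd p)) (fst p) (fst (snd p)))"
  shows "recursive_in X (\<lambda>e. rec_nat (a e) (\<lambda>k y. g e k y) (b e))"
proof -
  obtain pa where pa: "\<And>e. computes pa (map (\<lambda>x. x e) X) (a e)"
    using assms(1) by (auto simp: recursive_in_def)
  obtain pg where pg: "\<And>k y e. computes pg (k # y # map (\<lambda>x. x e) X) (g e k y)"
    using assms(3) by (auto simp: recursive_in_def comp_def)
  have rec: "computes (Prec pa pg) (k # map (\<lambda>x. x e) X) (rec_nat (a e) (\<lambda>k y. g e k y) k)" for k e
    by (induction k) (auto intro: computes.Prec_0 computes.Prec_Suc pa pg)
  have "recursive_in ((\<lambda>p. fst p) # map (\<lambda>x p. x (snd p)) X)
      (\<lambda>p. rec_nat (a (snd p)) (\<lambda>k y. g (snd p) k y) (fst p))"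
    unfolding recursive_in_def
    by (rule exI[of _ "Prec pa pg"]) (simp add: rec comp_def)
  then have "recursive_in X (\<lambda>e. (\<lambda>p. rec_nat (a (snd p)) (\<lambda>k y. g (snd p) k y) (fst p)) (b e, e))"
    by (rule recursive_in_comp) (use assms(2) in \<open>auto intro: recursive_in_var\<close>)
  then show ?thesis by simp
qed

section \<open>Arithmetic operations as recursive functions\<close>

named_theorems recursive_intros

lemmas [recursive_intros] = recursive_in_const recursive_in_Suc recursive_in_rec_nat

lemma recursive_in_add [recursive_intros]:
  assumes "recursive_in X a" "recursive_in X b"
  shows "recursive_in X (\<lambda>e. a e + b e)"
proof (rule recursive_in_comp2[OF _ assms])
  have "x + y = rec_nat x (\<lambda>k z. Suc z) y" for x y by (induction y) auto
  then show "recursive_in [fst, snd] (\<lambda>t. fst t + snd t)"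
    by (simp only:) (intro recursive_intros; rule recursive_in_var, simp)
qed

lemma recursive_in_mult [recursive_intros]:
  assumes "recursive_in X a" "recursive_in X b"
  shows "recursive_in X (\<lambda>e. a e * b e)"
proof (rule recursive_in_comp2[OF _ assms])
  have "x * y = rec_nat 0 (\<lambda>k z. z + x) y" for x y by (induction y) auto
  then show "recursive_in [fst, snd] (\<lambda>t. fst t * snd t)"
    by (simp only:) (intro recursive_intros; rule recursive_in_var, simp)
qed

lemma recursive_in_diff [recursive_intros]:
  assumes "recursive_in X a" "recursive_in X b"
  shows "recursive_in X (\<lambda>e. a e - b e)"
proof (rule recursive_in_comp2[OF _ assms])
  \<comment> \<open>The inner recursion is the predecessor.\<close>
  have "x - y = rec_nat x (\<lambda>k z. rec_nat 0 (\<lambda>k y. k) z) y" for x y :: nat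
  proof (induction y)
    case (Suc y)
    then show ?case by (cases "x - y") (auto simp flip: Suc)
  qed simp
  then show "recursive_in [fst, snd] (\<lambda>t. fst t - snd t)"
    by (simp only:) (intro recursive_intros; rule recursive_in_var, simp)
qed

lemma recursive_in_power [recursive_intros]:
  assumes "recursive_in X a" "recursive_in X b"
  shows "recursive_in X (\<lambda>e. a e ^ b e)"
proof (rule recursive_in_comp2[OF _ assms])
  have "x ^ y = rec_nat 1 (\<lambda>k z. z * x) y" for x y :: nat by (induction y) auto
  then show "recursive_in [fst, snd] (\<lambda>t. fst t ^ snd t)"
    by (simp only:) (intro recursive_intros; rule recursive_in_var, simp)
qed

lemma recursive_in_fact [recursive_intros]:
  assumes "recursive_in X a"
  shows "recursive_in X (\<lambda>e. fact (a e))"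
proof (rule recursive_in_comp1[OF _ assms])
  have "fact x = rec_nat (1 :: nat) (\<lambda>k z. Suc k * z) x" for x by (induction x) auto
  then have eq: "fact = (\<lambda>x. rec_nat (1 :: nat) (\<lambda>k z. Suc k * z) x)" by blast
  show "recursive_in [\<lambda>x. x] fact"
    unfolding eq by (intro recursive_intros; rule recursive_in_var, simp)
qed

lemma recursive_in_funpow [recursive_intros]:
  assumes "recursive_in X a" "recursive_in X b"
    "recursive_in ((\<lambda>p. fst p) # (\<lambda>p. fst (snd p)) # map (\<lambda>x p. x (snd (snd p))) X)
      (\<lambda>p. g (snd (snd p)) (fst (snd p)))"
  shows "recursive_in X (\<lambda>e. ((\<lambda>y. g e y) ^^ b e) (a e))"
proof -
  have "(f ^^ k) z = rec_nat z (\<lambda>k y. f y) k" for f and k z :: nat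
    by (induction k) auto
  then show ?thesis using recursive_in_rec_nat[OF assms] by simp
qed

lemma recursive_in_sum [recursive_intros]:
  assumes "recursive_in X b"
    "recursive_in ((\<lambda>p. fst p) # (\<lambda>p. fst (snd p)) # map (\<lambda>x p. x (snd (snd p))) X)
      (\<lambda>p. h (snd (snd p)) (fst p))"
  shows "recursive_in X (\<lambda>e. \<Sum>i<b e. h e i)"
proof -
  have "(\<Sum>i<k. f i) = rec_nat 0 (\<lambda>i z. z + f i) k" for f :: "nat \<Rightarrow> nat" and k
    by (induction k) auto
  then show ?thesis
    by (simp only:) (intro recursive_intros assms(1) assms(2); rule recursive_in_var, simp)
qed

lemma recursive_in_of_bool_eq [recursive_intros]:
  assumes "recursive_in X a" "recursive_in X b"
  shows "recursive_in X (\<lambda>e. of_bool (a e = b e))"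
proof -
  have "of_bool (x = y) = 1 - ((x - y) + (y - x))" for x y :: nat by auto
  then show ?thesis by (simp only:) (intro recursive_intros assms)
qed

lemma recursive_in_div [recursive_intros]:
  assumes "recursive_in X a" "recursive_in X b"
  shows "recursive_in X (\<lambda>e. a e div b e)"
proof (rule recursive_in_comp2[OF _ assms])
  \<comment> \<open>The sum counts the \<open>q\<close> with \<open>Suc q * y \<le> x\<close>; the
    leading factor is \<open>0\<close> for \<open>y = 0\<close>, matching the convention for
    division by zero.\<close>
  have "x div y = (1 - (1 - y)) * (\<Sum>q<x. of_bool (Suc q * y - x = 0))" for x y :: nat
  proof (cases "y = 0")
    case False
    have "{q. q < x \<and> Suc q * y - x = 0} = {..<x div y}"
    proof (intro equalityI subsetI)
      fix q assume "q \<in> {q. q < x \<and> Suc q * y - x = 0}"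
      then show "q \<in> {..<x div y}"
        using False by (simp add: less_eq_div_iff_mult_less_eq flip: Suc_le_eq)
    next
      fix q assume q: "q \<in> {..<x div y}"
      then have "Suc q * y \<le> x"
        using False by (simp add: less_eq_div_iff_mult_less_eq flip: Suc_le_eq)
      moreover have "q < x" using q div_le_dividend[of x y] by (simp del: div_le_dividend)
      ultimately show "q \<in> {q. q < x \<and> Suc q * y - x = 0}" by simp
    qed
    then have "(\<Sum>q<x. of_bool (Suc q * y - x = 0)) = x div y"
      by (simp add: sum.If_cases of_bool_def Int_def)
    then show ?thesis using False by simp
  qed simp
  then show "recursive_in [fst, snd] (\<lambda>t. fst t div snd t)"
    by (simp only:) (intro recursive_intros; rule recursive_in_var, simp)
qed

lemma recursive_in_mod [recursive_intros]:
  assumes "recursive_in X a" "recursive_in X b"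
  shows "recursive_in X (\<lambda>e. a e mod b e)"
  unfolding minus_mult_div_eq_mod[symmetric] by (intro recursive_intros assms)

section \<open>Decoding pairs and lists\<close>

text \<open>Bounded search for the inverse of Cantor pairing: exactly one pair \<open>(a, b)\<close>
  has code \<open>k\<close>, so at most one summand is nonzero.\<close>

definition pair_fst :: "nat \<Rightarrow> nat" where
  "pair_fst k = (\<Sum>a<Suc k. \<Sum>b<Suc k. a * of_bool ((a + b) * Suc (a + b) div 2 + a = k))"

definition pair_snd :: "nat \<Rightarrow> nat" where
  "pair_snd k = (\<Sum>a<Suc k. \<Sum>b<Suc k. b * of_bool ((a + b) * Suc (a + b) div 2 + a = k))"

lemma pair_fst_prod_encode [simp]: "pair_fst (prod_encode (x, y)) = x"
  and pair_snd_prod_encode [simp]: "pair_snd (prod_encode (x, y)) = y"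
proof -
  define k where "k = prod_encode (x, y)"
  have eq: "(a + b) * Suc (a + b) div 2 + a = k \<longleftrightarrow> a = x \<and> b = y" for a b
  proof -
    have "(a + b) * Suc (a + b) div 2 + a = prod_encode (a, b)"
      by (simp add: prod_encode_def triangle_def)
    then show ?thesis by (simp add: k_def prod_encode_eq)
  qed
  have "x < Suc k" "y < Suc k" by (simp_all add: k_def less_Suc_eq_le le_prod_encode_1 le_prod_encode_2)
  then have "(\<Sum>a<Suc k. \<Sum>b<Suc k. g a b * of_bool (a = x \<and> b = y)) = g x y" for g :: "nat \<Rightarrow> nat \<Rightarrow> nat"
  proof -
    have "(\<Sum>a<Suc k. \<Sum>b<Suc k. g a b * of_bool (a = x \<and> b = y)) =
        (\<Sum>a<Suc k. if a = x then (\<Sum>b<Suc k. if b = y then g x b else 0) else 0)"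
      by (intro sum.cong refl) (auto intro!: sum.cong)
    then show ?thesis using \<open>x < Suc k\<close> \<open>y < Suc k\<close> by (simp del: sum.lessThan_Suc)
  qed
  from this[of "\<lambda>a b. a"] this[of "\<lambda>a b. b"]
  show "pair_fst (prod_encode (x, y)) = x" "pair_snd (prod_encode (x, y)) = y"
    unfolding pair_fst_def pair_snd_def k_def[symmetric] eq by this+
qed

lemma recursive_in_pair_fst [recursive_intros]:
  assumes "recursive_in X a"
  shows "recursive_in X (\<lambda>e. pair_fst (a e))"
  by (rule recursive_in_comp1[OF _ assms])
    (unfold pair_fst_def, intro recursive_intros; rule recursive_in_var, simp)

lemma recursive_in_pair_snd [recursive_intros]:
  assumes "recursive_in X a"
  shows "recursive_in X (\<lambda>e. pair_snd (a e))"
  by (rule recursive_in_comp1[OF _ assms])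
    (unfold pair_snd_def, intro recursive_intros; rule recursive_in_var, simp)

text \<open>The code of \<open>x # xs\<close> is the successor of the code of the pair of
  \<open>x\<close> and \<open>list_encode xs\<close>; hence the subtraction before each
  projection.\<close>

definition code_nth :: "nat \<Rightarrow> nat \<Rightarrow> nat" where
  "code_nth c i = pair_fst (((\<lambda>c. pair_snd (c - 1)) ^^ i) c - 1)"

lemma code_nth_list_encode: "i < length xs \<Longrightarrow> code_nth (list_encode xs) i = xs ! i"
proof (induction xs arbitrary: i)
  case (Cons x xs)
  then show ?case
    by (cases i) (simp_all add: code_nth_def funpow_Suc_right del: funpow.simps(2))
qed simp

lemma recursive_in_code_nth [recursive_intros]:
  assumes "recursive_in X a" "recursive_in X b"
  shows "recursive_in X (\<lambda>e. code_nth (a e) (b e))"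
  by (rule recursive_in_comp2[OF _ assms])
    (unfold code_nth_def, intro recursive_intros; rule recursive_in_var, simp)

section \<open>The equicontinuity test as a recursive function\<close>

definition digit :: "nat \<Rightarrow> nat \<Rightarrow> nat \<Rightarrow> nat" where
  "digit m C q = C div m ^ q mod m"

text \<open>
  A configuration of period \<open>L\<close> is coded by the number whose base \<open>m\<close> digit at \<open>p * n + j\<close> is component
  \<open>j\<close> at position \<open>p < L\<close>. In \<open>code_step\<close> the index \<open>d\<close> runs over pairs (matrix number, column), and
  \<open>r * (L - 1)\<close> stands for \<open>- r\<close> modulo \<open>L\<close>. The entries of the matrices follow \<open>m\<close>, \<open>n\<close>, \<open>r\<close> in the
  list coded by \<open>c\<close>.
\<close>

definition code_step :: "nat \<Rightarrow> nat \<Rightarrow> nat \<Rightarrow> nat \<Rightarrow> nat \<Rightarrow> nat \<Rightarrow> nat" where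
  "code_step c m n r L C =
    (\<Sum>q<n * L. m ^ q * ((\<Sum>d<n * (2 * r + 1).
      code_nth c (3 + (d div n * n + q mod n) * n + d mod n) *
      digit m C ((q div n + d div n + r * (L - 1)) mod L * n + d mod n)) mod m))"

definition power_bound :: "nat \<Rightarrow> nat \<Rightarrow> nat" where
  "power_bound m n = m * fact (n * m) * fact (m ^ (n * n))"

text \<open>The period \<open>4 * N * r + 1\<close> is the width of the window of radius
  \<open>2 * N * r\<close> on which a value of the power \<open>2 * N\<close> depends. Truncated
  subtraction turns the number of failing codes into a truth value.\<close>

definition periodicity_test :: "nat \<Rightarrow> nat \<Rightarrow> nat \<Rightarrow> nat \<Rightarrow> nat \<Rightarrow> nat" where
  "periodicity_test c m n r N = 1 - (\<Sum>C<m ^ (n * (4 * N * r + 1)).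
    1 - of_bool (((\<lambda>C. code_step c m n r (4 * N * r + 1) C) ^^ N) C =
      ((\<lambda>C. code_step c m n r (4 * N * r + 1) C) ^^ (2 * N)) C))"

definition equicontinuity_test :: "nat \<Rightarrow> nat" where
  "equicontinuity_test c = periodicity_test c (code_nth c 0) (code_nth c 1) (code_nth c 2)
    (power_bound (code_nth c 0) (code_nth c 1))"

lemma recursive_in_digit [recursive_intros]:
  assumes "recursive_in X a" "recursive_in X b" "recursive_in X c"
  shows "recursive_in X (\<lambda>e. digit (a e) (b e) (c e))"
  unfolding digit_def by (intro recursive_intros assms)

lemma recursive_in_code_step [recursive_intros]:
  assumes "recursive_in X c" "recursive_in X m" "recursive_in X n" "recursive_in X r"
    "recursive_in X L" "recursive_in X C"
  shows "recursive_in X (\<lambda>e. code_step (c e) (m e) (n e) (r e) (L e) (C e))"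
proof -
  \<comment> \<open>The arguments become projections of a nested tuple, so that the rules act on
    plain variables; the actual arguments are substituted afterwards.\<close>
  let ?V = "[\<lambda>t. fst t, \<lambda>t. fst (snd t), \<lambda>t. fst (snd (snd t)), \<lambda>t. fst (snd (snd (snd t))),
    \<lambda>t. fst (snd (snd (snd (snd t)))), \<lambda>t. snd (snd (snd (snd (snd t))))]"
  have "recursive_in ?V (\<lambda>t. code_step (fst t) (fst (snd t)) (fst (snd (snd t)))
    (fst (snd (snd (snd t)))) (fst (snd (snd (snd (snd t))))) (snd (snd (snd (snd (snd t))))))"
    unfolding code_step_def by (intro recursive_intros; rule recursive_in_var, simp)
  from recursive_in_comp[OF this, where X = X and s = "\<lambda>e. (c e, m e, n e, r e, L e, C e)"] assms show ?thesis
    by simp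
qed

lemma recursive_in_periodicity_test:
  assumes "recursive_in X c" "recursive_in X m" "recursive_in X n" "recursive_in X r"
    "recursive_in X N"
  shows "recursive_in X (\<lambda>e. periodicity_test (c e) (m e) (n e) (r e) (N e))"
proof -
  let ?V = "[\<lambda>t. fst t, \<lambda>t. fst (snd t), \<lambda>t. fst (snd (snd t)), \<lambda>t. fst (snd (snd (snd t))),
    \<lambda>t. snd (snd (snd (snd t)))]"
  have "recursive_in ?V (\<lambda>t. periodicity_test (fst t) (fst (snd t)) (fst (snd (snd t)))
    (fst (snd (snd (snd t)))) (snd (snd (snd (snd t)))))"
    unfolding periodicity_test_def by (intro recursive_intros; rule recursive_in_var, simp)
  from recursive_in_comp[OF this, where X = X and s = "\<lambda>e. (c e, m e, n e, r e, N e)"] assms show ?thesis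
    by simp
qed

lemma recursive_in_equicontinuity_test: "recursive_in [\<lambda>x. x] equicontinuity_test"
  unfolding equicontinuity_test_def power_bound_def
  by (intro recursive_in_periodicity_test recursive_intros; rule recursive_in_var, simp)

section \<open>Reduction to equality of two powers\<close>

definition residue_config :: "nat \<Rightarrow> nat \<Rightarrow> int_config \<Rightarrow> int \<Rightarrow> nat vec" where
  "residue_config m n v = (\<lambda>i. vec n (\<lambda>j. nat (v i j mod int m)))"

text \<open>The lift of the automaton to the integers, without reduction modulo \<open>m\<close>, so
  that configurations can be subtracted and divided.\<close>

definition int_lca :: "nat \<Rightarrow> nat \<Rightarrow> (int \<Rightarrow> nat mat) \<Rightarrow> int_config \<Rightarrow> int_config" where
  "int_lca n r A v = (\<lambda>i j. \<Sum>z = - int r..int r. \<Sum>l<n. int (A z $$ (j, l)) * v (i + z) l)"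

lemma local_linear_int_lca: "local_linear n r (int_lca n r A)"
  unfolding local_linear_def
proof (intro conjI allI impI)
  fix v :: int_config and j
  assume "\<forall>i j. \<bar>i\<bar> \<le> int r \<longrightarrow> j < n \<longrightarrow> v i j = 0"
  then show "int_lca n r A v 0 j = 0"
    unfolding int_lca_def by (intro sum.neutral ballI) auto
next
  fix v w k s
  show "int_lca n r A (v + w) = int_lca n r A v + int_lca n r A w"
    by (intro ext) (simp add: int_lca_def distrib_left sum.distrib)
  show "int_lca n r A (smul k v) = smul k (int_lca n r A v)"
    by (intro ext) (simp add: int_lca_def sum_distrib_left mult.left_commute)
  show "int_lca n r A (shift s v) = shift s (int_lca n r A v)"
    by (intro ext) (simp add: int_lca_def add.commute add.left_commute)
qed

lemma residue_config_eq_iff: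
  assumes "m > 0"
  shows "residue_config m n v i = residue_config m n w i \<longleftrightarrow> (\<forall>j<n. int m dvd v i j - w i j)"
proof -
  have "nat (x mod int m) = nat (y mod int m) \<longleftrightarrow> int m dvd x - y" for x y
    using assms by (simp add: mod_eq_dvd_iff nat_eq_iff)
  then show ?thesis by (auto simp: residue_config_def vec_eq_iff)
qed

lemma residue_config_in_configs: "m > 0 \<Longrightarrow> residue_config m n v \<in> configs (residue_vecs m n)"
  by (auto simp: residue_config_def configs_def residue_vecs_def nat_less_iff)

lemma configs_residue_config:
  assumes "c \<in> configs (residue_vecs m n)"
  obtains v where "c = residue_config m n v"
proof
  have c: "dim_vec (c i) = n" "j < n \<Longrightarrow> c i $ j < m" for i j
    using assms by (auto simp: configs_def residue_vecs_def Pi_iff)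
  show "c = residue_config m n (\<lambda>i j. int (c i $ j))"
    by (rule ext) (simp add: residue_config_def vec_eq_iff c)
qed

lemma configs_eq_range: "m > 0 \<Longrightarrow> configs (residue_vecs m n) = range (residue_config m n)"
  by (auto elim: configs_residue_config intro: residue_config_in_configs)

lemma lca_apply:
  assumes "\<And>z. z \<in> {- int r..int r} \<Longrightarrow> A z \<in> carrier_mat n n"
    and "\<And>i. dim_vec (c i) = n" and "j < n"
  shows "lca m n r A c i $ j = (\<Sum>z = - int r..int r. \<Sum>l<n. A z $$ (j, l) * c (i + z) $ l) mod m"
proof -
  have "(A z *\<^sub>v c (i + z)) $ j = (\<Sum>l<n. A z $$ (j, l) * c (i + z) $ l)" if "z \<in> {- int r..int r}" for z
    using assms(1)[OF that] assms(2,3) by (simp add: scalar_prod_def atLeast0LessThan)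
  then show ?thesis using assms(3) by (simp add: lca_def)
qed

lemma lca_cong:
  assumes "\<And>z. z \<in> {- int r..int r} \<Longrightarrow> c (i + z) = c' (i + z)"
  shows "lca m n r A c i = lca m n r A c' i"
  using assms by (simp add: lca_def)

lemma lca_funpow_local:
  assumes "\<And>x. \<bar>x - i\<bar> \<le> int (k * r) \<Longrightarrow> c x = c' x"
  shows "(lca m n r A ^^ k) c i = (lca m n r A ^^ k) c' i"
  using assms
proof (induction k arbitrary: i)
  case (Suc k)
  have "(lca m n r A ^^ k) c (i + z) = (lca m n r A ^^ k) c' (i + z)" if "z \<in> {- int r..int r}" for z
  proof (rule Suc.IH)
    fix x assume "\<bar>x - (i + z)\<bar> \<le> int (k * r)"
    then show "c x = c' x" using that by (intro Suc.prems) (simp, linarith)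
  qed
  then have "lca m n r A ((lca m n r A ^^ k) c) i = lca m n r A ((lca m n r A ^^ k) c') i"
    by (rule lca_cong)
  then show ?case by (simp only: funpow.simps comp_def)
qed simp

locale lca_instance =
  fixes m n r :: nat and A :: "int \<Rightarrow> nat mat"
  assumes m: "m > 0" and A: "\<And>z. z \<in> {- int r..int r} \<Longrightarrow> A z \<in> residue_mats m n"
begin

abbreviation F :: "(int \<Rightarrow> nat vec) \<Rightarrow> int \<Rightarrow> nat vec" where "F \<equiv> lca m n r A"
abbreviation G :: "int_config \<Rightarrow> int_config" where "G \<equiv> int_lca n r A"
abbreviation \<rho> :: "int_config \<Rightarrow> int \<Rightarrow> nat vec" where "\<rho> \<equiv> residue_config m n"
abbreviation X :: "(int \<Rightarrow> nat vec) set" where "X \<equiv> configs (residue_vecs m n)"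

lemma A_carrier: "z \<in> {- int r..int r} \<Longrightarrow> A z \<in> carrier_mat n n"
  using A by (auto simp: residue_mats_def)

lemma lca_residue_config: "F (\<rho> v) = \<rho> (G v)"
proof (rule ext, rule eq_vecI)
  fix i j assume "j < dim_vec (\<rho> (G v) i)"
  then have j: "j < n" by (simp add: residue_config_def)
  have "F (\<rho> v) i $ j =
      (\<Sum>z = - int r..int r. \<Sum>l<n. A z $$ (j, l) * \<rho> v (i + z) $ l) mod m"
    by (rule lca_apply[OF A_carrier _ j]) (simp_all add: residue_config_def)
  then have "int (F (\<rho> v) i $ j) =
      (\<Sum>z = - int r..int r. \<Sum>l<n. int (A z $$ (j, l)) * (v (i + z) l mod int m)) mod int m"
    using m by (simp add: residue_config_def zmod_int)
  also have "\<dots> = G v i j mod int m"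
    unfolding int_lca_def mod_eq_dvd_iff sum_subtractf[symmetric] right_diff_distrib[symmetric]
    by (intro dvd_sum dvd_mult) (simp add: minus_mod_eq_mult_div dvd_diff_commute)
  finally show "F (\<rho> v) i $ j = \<rho> (G v) i $ j"
    using j m by (simp add: residue_config_def flip: nat_int)
qed (simp add: residue_config_def lca_def)

lemma lca_funpow_residue_config: "(F ^^ k) (\<rho> v) = \<rho> ((G ^^ k) v)"
  by (induction k) (simp_all add: lca_residue_config)

lemma local_linear_G_funpow: "local_linear n (k * r) (G ^^ k)"
  by (intro local_linear_funpow local_linear_int_lca)

text \<open>The lift turns equality of powers into divisibility by \<open>m\<close>, the form in
  which the bound on the exponents is available.\<close>

lemma powers_eq_iff:
  "(\<forall>c\<in>X. (F ^^ a) c = (F ^^ b) c) \<longleftrightarrow> (\<forall>v. vanishes_mod n (int m) ((G ^^ a) v - (G ^^ b) v))"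
proof -
  have "(\<forall>c\<in>X. (F ^^ a) c = (F ^^ b) c) \<longleftrightarrow> (\<forall>v. (F ^^ a) (\<rho> v) = (F ^^ b) (\<rho> v))"
    by (simp add: configs_eq_range[OF m])
  also have "\<dots> \<longleftrightarrow> (\<forall>v. vanishes_mod n (int m) ((G ^^ a) v - (G ^^ b) v))"
    unfolding lca_funpow_residue_config vanishes_mod_def fun_eq_iff[of "\<rho> _"]
    by (simp add: residue_config_eq_iff[OF m])
  finally show ?thesis .
qed

lemma periodic_if_some_powers_eq:
  assumes "a < b" "\<forall>c\<in>X. (F ^^ a) c = (F ^^ b) c" "c \<in> X"
  shows "(F ^^ power_bound m n) c = (F ^^ (2 * power_bound m n)) c"
proof -
  have "vanishes_mod n (int m) ((G ^^ b) v - (G ^^ a) v)" for v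
    using assms(2) by (simp add: powers_eq_iff vanishes_mod_diff_commute[of n _ "(G ^^ b) v"])
  then have "\<forall>v. vanishes_mod n (int m) ((G ^^ power_bound m n) v - (G ^^ (2 * power_bound m n)) v)"
    using finitely_many_powers_bound[OF local_linear_int_lca m assms(1) _ power_bound_def] by blast
  then show ?thesis using assms(3) powers_eq_iff by blast
qed

section \<open>Equicontinuity and powers of bounded radius\<close>

text \<open>One radius serves all powers; position \<open>0\<close> represents all positions by
  translation invariance.\<close>

definition bounded_radius :: "nat \<Rightarrow> bool" where
  "bounded_radius l \<longleftrightarrow>
    (\<forall>x\<in>X. \<forall>y\<in>X. (\<forall>i. \<bar>i\<bar> \<le> int l \<longrightarrow> x i = y i) \<longrightarrow> (\<forall>k. (F ^^ k) x 0 = (F ^^ k) y 0))"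

text \<open>Powers of uniformly bounded radius are determined modulo \<open>m\<close> by their
  values at \<open>0\<close> on the unit impulses in one window. There are finitely many such
  tables, so two powers agree.\<close>

lemma some_powers_eq_if_bounded_radius:
  assumes "bounded_radius l"
  obtains a b where "a < b" "\<forall>c\<in>X. (F ^^ a) c = (F ^^ b) c"
proof -
  define \<delta> :: "int \<times> nat \<Rightarrow> int_config" where "\<delta> t = (\<lambda>i j. if (i, j) = t then 1 else 0)" for t
  define W where "W = {- int l..int l} \<times> {..<n}"
  define g where "g k = restrict (\<lambda>(t, j). (G ^^ k) (\<delta> t) 0 j mod int m) (W \<times> {..<n})" for k
  have "g k \<in> W \<times> {..<n} \<rightarrow>\<^sub>E {0..<int m}" for k
    using m unfolding g_def restrict_PiE_iff by (simp add: split_beta)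
  then have "range g \<subseteq> W \<times> {..<n} \<rightarrow>\<^sub>E {0..<int m}" by blast
  moreover have "finite (W \<times> {..<n} \<rightarrow>\<^sub>E {0..<int m})"
    by (intro finite_PiE) (simp_all add: W_def)
  ultimately have "finite (range g)" by (rule finite_subset)
  then have "\<not> inj g" using finite_imageD by blast
  then obtain a b where ab: "a < b" "g a = g b"
    by (auto simp: inj_on_def) (metis linorder_neqE_nat)
  have \<delta>: "int m dvd (G ^^ a) (\<delta> t) 0 j - (G ^^ b) (\<delta> t) 0 j" if "t \<in> W" "j < n" for t j
  proof -
    have "g a (t, j) = g b (t, j)" using ab by simp
    then show ?thesis using that by (simp add: g_def mod_eq_dvd_iff)
  qed
  have *: "int m dvd (G ^^ a) v 0 j - (G ^^ b) v 0 j" if j: "j < n" for v j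
  proof -
    \<comment> \<open>The part of \<open>v\<close> inside the window, as a combination of unit
      impulses.\<close>
    define w where "w = (\<Sum>t\<in>W. smul (v (fst t) (snd t)) (\<delta> t))"
    have w: "w i j = v i j" if "\<bar>i\<bar> \<le> int l" "j < n" for i j
    proof -
      have "w i j = (\<Sum>t\<in>W. if t = (i, j) then v i j else 0)"
        unfolding w_def sum_fun_apply by (intro sum.cong) (auto simp: \<delta>_def)
      also have "\<dots> = v i j" using that by (auto simp: W_def)
      finally show ?thesis .
    qed
    have "\<rho> v i = \<rho> w i" if "\<bar>i\<bar> \<le> int l" for i
      using w[OF that] by (simp add: residue_config_def vec_eq_iff)
    then have "(F ^^ k) (\<rho> v) 0 = (F ^^ k) (\<rho> w) 0" for k
      using assms residue_config_in_configs[OF m] by (simp add: bounded_radius_def)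
    then have vw: "int m dvd (G ^^ k) v 0 j - (G ^^ k) w 0 j" for k
      using j by (simp add: lca_funpow_residue_config residue_config_eq_iff[OF m])
    have Gw: "(G ^^ k) w 0 j = (\<Sum>t\<in>W. v (fst t) (snd t) * (G ^^ k) (\<delta> t) 0 j)" for k
      unfolding w_def local_linear_sum[OF local_linear_G_funpow] local_linear_smul[OF local_linear_G_funpow]
      by (simp add: sum_fun_apply)
    have "int m dvd (G ^^ a) w 0 j - (G ^^ b) w 0 j"
      unfolding Gw sum_subtractf[symmetric] right_diff_distrib[symmetric]
      using \<delta> j by (intro dvd_sum dvd_mult) auto
    from dvd_diff[OF dvd_add[OF vw[of a] this] vw[of b]] show ?thesis by simp
  qed
  have "vanishes_mod n (int m) ((G ^^ a) v - (G ^^ b) v)" for v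
    unfolding vanishes_mod_def
  proof (intro allI impI)
    fix i j assume "j < n"
    then show "int m dvd ((G ^^ a) v - (G ^^ b) v) i j"
      using *[of j "shift i v"] by (simp add: local_linear_shift[OF local_linear_G_funpow])
  qed
  then show thesis using that ab powers_eq_iff by blast
qed

lemma bounded_radius_if_equicontinuous:
  assumes "Metric_space.equicontinuous X config_dist F"
  obtains l where "bounded_radius l"
proof -
  \<comment> \<open>Distance below \<open>1\<close> means equality at position
    \<open>0\<close>.\<close>
  obtain \<delta> :: real where \<delta>: "\<delta> > 0" "\<And>x y k. x \<in> X \<Longrightarrow> y \<in> X \<Longrightarrow> config_dist x y < \<delta> \<Longrightarrow>
      config_dist ((F ^^ k) x) ((F ^^ k) y) < 1"
    using assms[unfolded Metric_space.equicontinuous_def[OF Metric_space_configs], rule_format, of 1]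
    by auto
  obtain l where "(1 / 2) ^ l < \<delta>"
    using real_arch_pow_inv[of \<delta> "1 / 2"] \<delta>(1) by auto
  have "bounded_radius l"
    unfolding bounded_radius_def
  proof (intro ballI impI allI)
    fix x y k assume "x \<in> X" "y \<in> X" "\<forall>i. \<bar>i\<bar> \<le> int l \<longrightarrow> x i = y i"
    then have "config_dist x y < (1 / 2) ^ l" unfolding config_dist_less_iff by blast
    then have "config_dist x y < \<delta>" using \<open>(1 / 2) ^ l < \<delta>\<close> by (rule less_trans)
    with \<open>x \<in> X\<close> \<open>y \<in> X\<close> have "config_dist ((F ^^ k) x) ((F ^^ k) y) < 1" by (rule \<delta>(2))
    then have "config_dist ((F ^^ k) x) ((F ^^ k) y) < (1 / 2) ^ 0" by simp
    then show "(F ^^ k) x 0 = (F ^^ k) y 0" by (simp only: config_dist_less_iff)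
  qed
  then show thesis by (rule that)
qed

text \<open>Every power equals one of exponent below \<open>b\<close>, hence of radius at most
  \<open>b * r\<close>; agreement up to \<open>l + b * r\<close> thus persists up to
  \<open>l\<close>.\<close>

lemma equicontinuous_if_some_powers_eq:
  assumes "a < b" and eq: "\<forall>c\<in>X. (F ^^ a) c = (F ^^ b) c"
  shows "Metric_space.equicontinuous X config_dist F"
  unfolding Metric_space.equicontinuous_def[OF Metric_space_configs]
proof (intro allI impI)
  fix \<epsilon> :: real assume "\<epsilon> > 0"
  then obtain l where l: "(1 / 2) ^ l < \<epsilon>" using real_arch_pow_inv[of \<epsilon> "1 / 2"] by auto
  have red: "\<exists>k'<b. \<forall>c\<in>X. (F ^^ k) c = (F ^^ k') c" for k
  proof (induction k rule: less_induct)
    case (less k)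
    show ?case
    proof (cases "k < b")
      case True
      then show ?thesis by blast
    next
      case False
      define q where "q = k - b"
      have k: "k = q + b" using False by (simp add: q_def)
      have "(F ^^ k) c = (F ^^ (q + a)) c" if "c \<in> X" for c
        unfolding k funpow_add comp_def using eq that by simp
      moreover obtain k' where "k' < b" "\<forall>c\<in>X. (F ^^ (q + a)) c = (F ^^ k') c"
        using less.IH[of "q + a"] \<open>a < b\<close> k by auto
      ultimately show ?thesis by auto
    qed
  qed
  have "config_dist ((F ^^ k) x) ((F ^^ k) y) < \<epsilon>"
    if "x \<in> X" "y \<in> X" "config_dist x y < (1 / 2) ^ (l + b * r)" for x y k
  proof -
    obtain k' where k': "k' < b" "\<forall>c\<in>X. (F ^^ k) c = (F ^^ k') c" using red by blast
    then have "k' * r \<le> b * r" by simp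
    then have le: "int (k' * r) \<le> int (b * r)" by (simp only: of_nat_le_iff)
    have xy: "\<And>i. \<bar>i\<bar> \<le> int (l + b * r) \<Longrightarrow> x i = y i"
      using that(3) unfolding config_dist_less_iff by blast
    have "(F ^^ k') x i = (F ^^ k') y i" if "\<bar>i\<bar> \<le> int l" for i
    proof (rule lca_funpow_local)
      fix i' assume "\<bar>i' - i\<bar> \<le> int (k' * r)"
      with le that have "\<bar>i'\<bar> \<le> int l + int (b * r)" by linarith
      then show "x i' = y i'" by (intro xy) simp
    qed
    then have "config_dist ((F ^^ k') x) ((F ^^ k') y) < (1 / 2) ^ l"
      unfolding config_dist_less_iff by blast
    moreover have "(F ^^ k) x = (F ^^ k') x" "(F ^^ k) y = (F ^^ k') y"
      using k'(2) that(1,2) by blast+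
    ultimately show ?thesis using l by (simp only:)
  qed
  then show "\<exists>\<delta>>0. \<forall>x\<in>X. \<forall>y\<in>X. config_dist x y < \<delta> \<longrightarrow>
      (\<forall>k. config_dist ((F ^^ k) x) ((F ^^ k) y) < \<epsilon>)"
    by (intro exI[of _ "(1 / 2) ^ (l + b * r)"] conjI) (simp, blast)
qed

lemma equicontinuous_iff:
  "Metric_space.equicontinuous X config_dist F \<longleftrightarrow>
    (\<forall>c\<in>X. (F ^^ power_bound m n) c = (F ^^ (2 * power_bound m n)) c)"
proof
  assume "Metric_space.equicontinuous X config_dist F"
  then obtain l where "bounded_radius l" by (rule bounded_radius_if_equicontinuous)
  then obtain a b where "a < b" "\<forall>c\<in>X. (F ^^ a) c = (F ^^ b) c"
    by (rule some_powers_eq_if_bounded_radius)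
  then show "\<forall>c\<in>X. (F ^^ power_bound m n) c = (F ^^ (2 * power_bound m n)) c"
    using periodic_if_some_powers_eq by blast
next
  assume "\<forall>c\<in>X. (F ^^ power_bound m n) c = (F ^^ (2 * power_bound m n)) c"
  \<comment> \<open>The bound is positive, so the two exponents are different.\<close>
  moreover have "power_bound m n < 2 * power_bound m n" using m by (simp add: power_bound_def)
  ultimately show "Metric_space.equicontinuous X config_dist F"
    by (intro equicontinuous_if_some_powers_eq)
qed

section \<open>The dichotomy between sensitivity and equicontinuity\<close>

text \<open>Sensitivity contradicts equicontinuity already at one configuration. Without
  equicontinuity no radius bounds all powers, and by linearity the difference of two configurations
  that agree near \<open>0\<close> but are separated by a power perturbs every \<open>c\<close> in
  the same way.\<close>

lemma sensitive_iff:
  "Metric_space.sensitive X config_dist F \<longleftrightarrow> \<not> Metric_space.equicontinuous X config_dist F"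
proof
  assume sens: "Metric_space.sensitive X config_dist F"
  show "\<not> Metric_space.equicontinuous X config_dist F"
  proof
    assume equi: "Metric_space.equicontinuous X config_dist F"
    obtain \<epsilon> where \<epsilon>: "\<epsilon> > 0" and far: "\<And>x \<delta>. x \<in> X \<Longrightarrow> \<delta> > 0 \<Longrightarrow> \<exists>y\<in>X. 0 < config_dist y x \<and>
        config_dist y x < \<delta> \<and> (\<exists>k. config_dist ((F ^^ k) y) ((F ^^ k) x) > \<epsilon>)"
      using sens unfolding Metric_space.sensitive_def[OF Metric_space_configs] by blast
    obtain \<delta> where "\<delta> > 0" and near: "\<And>x y k. x \<in> X \<Longrightarrow> y \<in> X \<Longrightarrow> config_dist x y < \<delta> \<Longrightarrow>
        config_dist ((F ^^ k) x) ((F ^^ k) y) < \<epsilon>"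
      using equi \<epsilon> unfolding Metric_space.equicontinuous_def[OF Metric_space_configs] by blast
    have "\<rho> 0 \<in> X" by (rule residue_config_in_configs[OF m])
    then obtain y k where y: "y \<in> X" "config_dist y (\<rho> 0) < \<delta>"
      "config_dist ((F ^^ k) y) ((F ^^ k) (\<rho> 0)) > \<epsilon>"
      using far[OF _ \<open>\<delta> > 0\<close>] by blast
    from near[OF y(1) \<open>\<rho> 0 \<in> X\<close> y(2), of k] y(3) show False by simp
  qed
next
  assume not_equi: "\<not> Metric_space.equicontinuous X config_dist F"
  have unbounded: "\<not> bounded_radius l" for l
  proof
    assume "bounded_radius l"
    then obtain a b where "a < b" "\<forall>c\<in>X. (F ^^ a) c = (F ^^ b) c"
      by (rule some_powers_eq_if_bounded_radius)
    with not_equi show False using equicontinuous_if_some_powers_eq by blast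
  qed
  show "Metric_space.sensitive X config_dist F"
    unfolding Metric_space.sensitive_def[OF Metric_space_configs]
  \<comment> \<open>Configurations that differ at position \<open>0\<close> have distance
    \<open>1\<close>.\<close>
  proof (intro exI[of _ "1 / 2"] conjI ballI allI impI)
    fix c and \<delta> :: real assume "c \<in> X" "\<delta> > 0"
    obtain u where u: "c = \<rho> u" using \<open>c \<in> X\<close> by (rule configs_residue_config)
    obtain l where l: "(1 / 2) ^ l < \<delta>"
      using real_arch_pow_inv[of \<delta> "1 / 2"] \<open>\<delta> > 0\<close> by auto
    obtain x y k where "x \<in> X" "y \<in> X" and xy: "\<And>i. \<bar>i\<bar> \<le> int l \<Longrightarrow> x i = y i" and
        k: "(F ^^ k) x 0 \<noteq> (F ^^ k) y 0"
      using unbounded[of l] by (auto simp: bounded_radius_def)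
    obtain v w where vw: "x = \<rho> v" "y = \<rho> w"
      using \<open>x \<in> X\<close> \<open>y \<in> X\<close> by (auto simp: configs_eq_range[OF m])
    define c' where "c' = \<rho> (u + (v - w))"
    have "config_dist c' c < (1 / 2) ^ l"
      unfolding config_dist_less_iff
    proof (intro allI impI)
      fix i assume "\<bar>i\<bar> \<le> int l"
      then show "c' i = c i"
        using xy[of i] by (simp add: c'_def u vw residue_config_eq_iff[OF m])
    qed
    have diff: "(G ^^ k) (u + (v - w)) = (G ^^ k) u + ((G ^^ k) v - (G ^^ k) w)"
      by (simp only: local_linear_add[OF local_linear_G_funpow] local_linear_diff[OF local_linear_G_funpow])
    have "(F ^^ k) c' 0 = (F ^^ k) c 0 \<longleftrightarrow> (F ^^ k) x 0 = (F ^^ k) y 0"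
      by (simp only: c'_def u vw lca_funpow_residue_config residue_config_eq_iff[OF m] diff
          plus_fun_apply minus_apply add_diff_cancel_left')
    with k have "(F ^^ k) c' 0 \<noteq> (F ^^ k) c 0" by simp
    then have "\<not> config_dist ((F ^^ k) c') ((F ^^ k) c) < (1 / 2) ^ 0"
      unfolding config_dist_less_iff by simp
    then have far: "config_dist ((F ^^ k) c') ((F ^^ k) c) > 1 / 2" by simp
    have "c' \<noteq> c" using \<open>(F ^^ k) c' 0 \<noteq> (F ^^ k) c 0\<close> by auto
    then have "config_dist c' c > 0" by (simp add: config_dist_def)
    moreover have "c' \<in> X" unfolding c'_def by (rule residue_config_in_configs[OF m])
    ultimately show "\<exists>y\<in>X. 0 < config_dist y c \<and> config_dist y c < \<delta> \<and>
        (\<exists>k. 1 / 2 < config_dist ((F ^^ k) y) ((F ^^ k) c))"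
      using far l \<open>config_dist c' c < (1 / 2) ^ l\<close> by (intro bexI[of _ c']) auto
  qed simp
qed

end

section \<open>Correctness of the decision procedure\<close>

lemma sum_digits: "(\<Sum>q<Q. m ^ q * digit m C q) = C mod m ^ Q"
proof (induction Q)
  case (Suc Q)
  have "C mod m ^ Suc Q = m ^ Q * (C div m ^ Q mod m) + C mod m ^ Q"
    by (simp only: power_Suc2 mod_mult2_eq)
  then show ?case using Suc by (simp add: digit_def)
qed simp

lemma sum_power_less:
  fixes m :: nat
  assumes "\<And>q. q < Q \<Longrightarrow> a q < m"
  shows "(\<Sum>q<Q. m ^ q * a q) < m ^ Q"
  using assms
proof (induction Q)
  case (Suc Q)
  have "a Q + 1 \<le> m" using Suc.prems[of Q] by simp
  then have "m ^ Q * (a Q + 1) \<le> m ^ Q * m" by (rule mult_le_mono2)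
  moreover have "(\<Sum>q<Q. m ^ q * a q) < m ^ Q" using Suc by simp
  ultimately show ?case by (simp add: algebra_simps)
qed simp

text \<open>Summands of lower index add up to less than \<open>m ^ q\<close>, and those of higher
  index are multiples of \<open>m ^ Suc q\<close>.\<close>

lemma digit_sum_power:
  assumes "\<And>q. q < Q \<Longrightarrow> a q < m" "q < Q"
  shows "digit m (\<Sum>q<Q. m ^ q * a q) q = a q"
  using assms
proof (induction Q)
  case (Suc Q)
  define S where "S = (\<Sum>q<Q. m ^ q * a q)"
  have S: "S < m ^ Q" unfolding S_def using Suc.prems by (intro sum_power_less) simp
  have m: "m > 0" using Suc.prems(1)[OF Suc.prems(2)] by simp
  show ?case
  proof (cases "q = Q")
    case True
    have "(S + m ^ Q * a Q) div m ^ Q = a Q" using S m by simp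
    then show ?thesis using True Suc.prems by (simp add: digit_def S_def)
  next
    case False
    then have "q < Q" using Suc.prems by simp
    then obtain d where d: "Q = q + Suc d" using less_imp_Suc_add by auto
    have eq: "S + m ^ Q * a Q = S + m ^ q * (m * (m ^ d * a Q))"
      by (simp add: d power_add mult.assoc)
    have "(S + m ^ Q * a Q) div m ^ q = m * (m ^ d * a Q) + S div m ^ q"
      unfolding eq using m by (intro div_mult_self2) simp
    then have "(S + m ^ Q * a Q) div m ^ q mod m = S div m ^ q mod m"
      by (simp only: mod_mult_self4)
    then show ?thesis using Suc \<open>q < Q\<close> by (simp add: digit_def S_def)
  qed
qed simp

lemma nth_concat_uniform:
  assumes "\<And>xs. xs \<in> set xss \<Longrightarrow> length xs = n" "i < length xss" "j < n"
  shows "i * n + j < length (concat xss) \<and> concat xss ! (i * n + j) = xss ! i ! j"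
  using assms
proof (induction xss arbitrary: i)
  case (Cons xs xss)
  show ?case
  proof (cases i)
    case 0
    then show ?thesis using Cons.prems by (simp add: nth_append)
  next
    case (Suc i')
    then have "i' * n + j < length (concat xss) \<and> concat xss ! (i' * n + j) = xss ! i' ! j"
      using Cons.prems by (intro Cons.IH) auto
    moreover have "length xs = n" using Cons.prems by simp
    ultimately show ?thesis using Suc by (simp add: nth_append)
  qed
qed simp

lemma length_concat_uniform:
  "(\<And>xs. xs \<in> set xss \<Longrightarrow> length xs = n) \<Longrightarrow> length (concat xss) = length xss * n"
  by (induction xss) auto

lemma sum_lessThan_mult:
  fixes f :: "nat \<Rightarrow> 'a::comm_monoid_add"
  shows "(\<Sum>d<n * K. f d) = (\<Sum>y<K. \<Sum>l<n. f (y * n + l))"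
proof -
  have "(\<Sum>y<K. \<Sum>l<n. f (y * n + l)) = (\<Sum>y<K. sum f {y * n..<y * n + n})"
  proof (rule sum.cong[OF refl])
    fix y
    show "(\<Sum>l<n. f (y * n + l)) = sum f {y * n..<y * n + n}"
      using sum.shift_bounds_nat_ivl[of f 0 "y * n" n] by (simp add: lessThan_atLeast0 add.commute)
  qed
  also have "\<dots> = (\<Sum>d<n * K. f d)"
    by (simp add: sum.nat_group mult.commute)
  finally show ?thesis ..
qed

section \<open>Simulation on periodic configurations\<close>

context lca_instance
begin

abbreviation code :: nat where "code \<equiv> lca_code (m, n, r, A)"

text \<open>The summand \<open>3\<close> skips \<open>m\<close>, \<open>n\<close> and
  \<open>r\<close>; block \<open>y\<close> of \<open>n * n\<close> entries is the matrix of offset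
  \<open>int y - int r\<close>.\<close>

lemma code_nth_lca_code:
  "code_nth code 0 = m" "code_nth code (Suc 0) = n" "code_nth code 2 = r"
  "y < 2 * r + 1 \<Longrightarrow> j < n \<Longrightarrow> l < n \<Longrightarrow>
    code_nth code (3 + (y * n + j) * n + l) = A (int y - int r) $$ (j, l)"
proof -
  define E where "E = concat (map (\<lambda>z. concat (mat_to_list (A z))) [- int r..int r])"
  have c: "code = list_encode (m # n # r # E)" by (simp add: lca_code_def E_def)
  show "code_nth code 0 = m" "code_nth code (Suc 0) = n" "code_nth code 2 = r"
    unfolding c by (simp_all add: code_nth_list_encode del: list_encode.simps)
  assume y: "y < 2 * r + 1" and j: "j < n" and l: "l < n"
  have dim: "dim_row (A z) = n" "dim_col (A z) = n" if "z \<in> {- int r..int r}" for z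
    using A_carrier[OF that] by auto
  have row: "length xs = n" if "xs \<in> set (mat_to_list (A z))" "z \<in> {- int r..int r}" for xs z
    using that by (auto simp: mat_to_list_def dim)
  have len: "length (concat (mat_to_list (A z))) = n * n" if "z \<in> {- int r..int r}" for z
  proof -
    have "length (concat (mat_to_list (A z))) = length (mat_to_list (A z)) * n"
      by (rule length_concat_uniform) (rule row[OF _ that])
    also have "length (mat_to_list (A z)) = n" by (simp add: mat_to_list_def dim[OF that])
    finally show ?thesis .
  qed
  define z where "z = int y - int r"
  have z: "z \<in> {- int r..int r}" using y by (auto simp: z_def)
  have jl: "j * n + l < n * n \<and> concat (mat_to_list (A z)) ! (j * n + l) = A z $$ (j, l)"
  proof -
    have "j * n + l < length (concat (mat_to_list (A z))) \<and>
        concat (mat_to_list (A z)) ! (j * n + l) = mat_to_list (A z) ! j ! l"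
      by (rule nth_concat_uniform) (use j l dim[OF z] in \<open>auto intro: row[OF _ z] simp: mat_to_list_def\<close>)
    then show ?thesis
      unfolding len[OF z] using j l dim[OF z] by (simp add: mat_to_list_def)
  qed
  have "y * (n * n) + (j * n + l) < length E \<and> E ! (y * (n * n) + (j * n + l)) =
      map (\<lambda>z. concat (mat_to_list (A z))) [- int r..int r] ! y ! (j * n + l)"
    unfolding E_def using y jl len by (intro nth_concat_uniform) auto
  moreover have "map (\<lambda>z. concat (mat_to_list (A z))) [- int r..int r] ! y = concat (mat_to_list (A z))"
    using y nth_upto[of "- int r" y "int r"] by (simp add: z_def)
  moreover have "(y * n + j) * n + l = y * (n * n) + (j * n + l)" by (simp add: algebra_simps)
  ultimately show "code_nth code (3 + (y * n + j) * n + l) = A (int y - int r) $$ (j, l)"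
    unfolding c using jl by (subst code_nth_list_encode) (simp_all add: z_def eval_nat_numeral add.assoc)
qed

text \<open>Reading positions modulo \<open>L\<close> extends the digits to an
  \<open>L\<close>-periodic configuration.\<close>

definition decode :: "nat \<Rightarrow> nat \<Rightarrow> int \<Rightarrow> nat vec" where
  "decode L C = (\<lambda>i. vec n (\<lambda>j. digit m C (nat (i mod int L) * n + j)))"

lemma decode_in_configs: "decode L C \<in> X"
  using m by (auto simp: decode_def configs_def residue_vecs_def digit_def)

lemma position_less: "L > 0 \<Longrightarrow> j < n \<Longrightarrow> nat (i mod int L) * n + j < n * L"
proof -
  assume "L > 0" "j < n"
  then have "nat (i mod int L) + 1 \<le> L" by (simp add: nat_less_iff Suc_le_eq)
  then have "(nat (i mod int L) + 1) * n \<le> L * n" by (rule mult_le_mono1)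
  with \<open>j < n\<close> show ?thesis by (simp add: algebra_simps)
qed

lemma code_step_less: "code_step code m n r L C < m ^ (n * L)"
  unfolding code_step_def using m by (intro sum_power_less) simp

text \<open>Each summand of \<open>code_step\<close> is already reduced modulo \<open>m\<close>, so
  its digits can be read off without carries; they are the values of the local rule.\<close>

lemma decode_code_step:
  assumes L: "L > 0"
  shows "decode L (code_step code m n r L C) = F (decode L C)"
proof (rule ext, rule eq_vecI)
  fix i j assume "j < dim_vec (F (decode L C) i)"
  then have j: "j < n" by (simp add: lca_def)
  define p where "p = nat (i mod int L)"
  have p: "int p = i mod int L" using L by (simp add: p_def)
  have shift: "(p + y + r * (L - 1)) mod L = nat ((i + (int y - int r)) mod int L)" for y
  proof -
    obtain L' where "L = Suc L'" using L by (cases L) auto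
    then have "int (p + y + r * (L - 1)) = int p + (int y - int r) + int r * int L"
      by (simp add: algebra_simps)
    then have "int ((p + y + r * (L - 1)) mod L) = (int p + (int y - int r) + int r * int L) mod int L"
      by (simp only: zmod_int)
    also have "\<dots> = (int p + (int y - int r)) mod int L" by simp
    also have "\<dots> = (i + (int y - int r)) mod int L" by (simp only: p mod_add_left_eq)
    finally have "int ((p + y + r * (L - 1)) mod L) = (i + (int y - int r)) mod int L" .
    then show ?thesis by (metis nat_int)
  qed
  have "decode L (code_step code m n r L C) i $ j = digit m (code_step code m n r L C) (p * n + j)"
    using j by (simp add: decode_def p_def)
  also have "\<dots> = (\<Sum>d<n * (2 * r + 1).
      code_nth code (3 + (d div n * n + j) * n + d mod n) *
      digit m C ((p + d div n + r * (L - 1)) mod L * n + d mod n)) mod m"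
    unfolding code_step_def using j m position_less[OF L j, of i]
    by (subst digit_sum_power) (simp_all add: p_def)
  also have "(\<Sum>d<n * (2 * r + 1).
      code_nth code (3 + (d div n * n + j) * n + d mod n) *
      digit m C ((p + d div n + r * (L - 1)) mod L * n + d mod n)) =
      (\<Sum>y<2 * r + 1. \<Sum>l<n. A (int y - int r) $$ (j, l) * decode L C (i + (int y - int r)) $ l)"
    unfolding sum_lessThan_mult
    by (intro sum.cong refl) (use j shift in \<open>simp add: code_nth_lca_code decode_def\<close>)
  also have "\<dots> = (\<Sum>z = - int r..int r. \<Sum>l<n. A z $$ (j, l) * decode L C (i + z) $ l)"
    by (rule sum.reindex_bij_witness[where i = "\<lambda>z. nat (z + int r)" and j = "\<lambda>y. int y - int r"]) auto
  also have "\<dots> mod m = F (decode L C) i $ j"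
    by (rule lca_apply[OF A_carrier _ j, symmetric]) (simp_all add: decode_def)
  finally show "decode L (code_step code m n r L C) i $ j = F (decode L C) i $ j" .
qed (simp add: decode_def lca_def)

lemma decode_funpow_code_step:
  "L > 0 \<Longrightarrow> decode L ((code_step code m n r L ^^ k) C) = (F ^^ k) (decode L C)"
  by (induction k) (simp_all add: decode_code_step)

text \<open>A number below \<open>m ^ (n * L)\<close> is determined by its first
  \<open>n * L\<close> digits, and these are the components over one period.\<close>

lemma decode_inj:
  assumes "L > 0" "decode L C = decode L C'" "C < m ^ (n * L)" "C' < m ^ (n * L)"
  shows "C = C'"
proof -
  have "digit m C q = digit m C' q" if "q < n * L" for q
  proof -
    have "n > 0" using that by (cases n) auto
    have "q div n < L" using that by (simp add: less_mult_imp_div_less mult.commute)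
    then have "decode L D (int (q div n)) $ (q mod n) = digit m D q" for D
      using \<open>n > 0\<close> by (simp add: decode_def flip: of_nat_mod)
    then show ?thesis using assms(2) by metis
  qed
  then have "C mod m ^ (n * L) = C' mod m ^ (n * L)"
    unfolding sum_digits[symmetric] by (intro sum.cong) auto
  then show ?thesis using assms(3,4) by simp
qed

lemma decode_surj:
  assumes L: "L > 0" and c: "c \<in> X" and per: "\<And>i. c (i mod int L) = c i"
  obtains C where "C < m ^ (n * L)" "decode L C = c"
proof
  let ?a = "\<lambda>q. c (int (q div n)) $ (q mod n)"
  have cX: "dim_vec (c i) = n" "j < n \<Longrightarrow> c i $ j < m" for i j
    using c by (auto simp: configs_def residue_vecs_def Pi_iff)
  have less: "?a q < m" if "q < n * L" for q
    using that by (intro cX mod_less_divisor) (cases n, auto)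
  show "(\<Sum>q<n * L. m ^ q * ?a q) < m ^ (n * L)"
    by (rule sum_power_less) (rule less)
  show "decode L (\<Sum>q<n * L. m ^ q * ?a q) = c"
  proof (rule ext, rule eq_vecI)
    fix i j assume "j < dim_vec (c i)"
    then have j: "j < n" by (simp add: cX)
    have "decode L (\<Sum>q<n * L. m ^ q * ?a q) i $ j = ?a (nat (i mod int L) * n + j)"
      unfolding decode_def using j
      by (simp only: index_vec digit_sum_power[OF less position_less[OF L j]])
    also have "\<dots> = c i $ j"
      using j L by (simp add: per)
    finally show "decode L (\<Sum>q<n * L. m ^ q * ?a q) i $ j = c i $ j" .
  qed (simp add: decode_def cX)
qed

text \<open>The values of both powers at \<open>i\<close> depend only on the window of radius
  \<open>b * r\<close> around \<open>i\<close>. It has exactly \<open>L\<close> positions, so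
  repeating it periodically changes neither value.\<close>

lemma powers_eq_if_periodic:
  assumes "a \<le> b" and L: "L = 2 * b * r + 1"
    and eq: "\<And>c. c \<in> X \<Longrightarrow> (\<And>i. c (i mod int L) = c i) \<Longrightarrow> (F ^^ a) c = (F ^^ b) c" and "c \<in> X"
  shows "(F ^^ a) c = (F ^^ b) c"
proof
  fix i
  define s where "s = i - int (b * r)"
  define c' where "c' = (\<lambda>x. c (s + (x - s) mod int L))"
  have "c' \<in> X" using \<open>c \<in> X\<close> by (auto simp: c'_def configs_def)
  moreover have "c' (x mod int L) = c' x" for x
    by (simp add: c'_def mod_diff_left_eq)
  ultimately have "(F ^^ a) c' = (F ^^ b) c'" by (rule eq)
  have near: "c x = c' x" if "\<bar>x - i\<bar> \<le> int (b * r)" for x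
  proof -
    have "0 \<le> x - s" "x - s < int L" using that by (auto simp: s_def L)
    then show ?thesis by (simp add: c'_def)
  qed
  have local: "(F ^^ k) c i = (F ^^ k) c' i" if "k \<le> b" for k
  proof (rule lca_funpow_local, rule near)
    fix x assume "\<bar>x - i\<bar> \<le> int (k * r)"
    moreover have "int (k * r) \<le> int (b * r)" using that by (simp only: of_nat_le_iff mult_le_mono1)
    ultimately show "\<bar>x - i\<bar> \<le> int (b * r)" by linarith
  qed
  show "(F ^^ a) c i = (F ^^ b) c i"
    using local[of a] local[of b] \<open>a \<le> b\<close> \<open>(F ^^ a) c' = (F ^^ b) c'\<close> by simp
qed

text \<open>\<open>decode\<close> identifies the codes below \<open>m ^ (n * L)\<close> with the
  configurations of period \<open>L\<close> and carries \<open>code_step\<close> to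
  \<open>F\<close>, so trying all codes tries all these configurations.\<close>

lemma periodicity_test_eq:
  "periodicity_test code m n r N = (if \<forall>c\<in>X. (F ^^ N) c = (F ^^ (2 * N)) c then 1 else 0)"
proof -
  define L where "L = 4 * N * r + 1"
  have L: "L > 0" "L = 2 * (2 * N) * r + 1" by (simp_all add: L_def)
  define step where "step = code_step code m n r L"
  \<comment> \<open>Iterates stay in the range on which \<open>decode\<close> is injective.\<close>
  have less: "(step ^^ k) C < m ^ (n * L)" if "C < m ^ (n * L)" for k C
    using that by (cases k) (simp_all add: step_def code_step_less)
  have "(\<forall>c\<in>X. (F ^^ N) c = (F ^^ (2 * N)) c) \<longleftrightarrow>
      (\<forall>C<m ^ (n * L). (step ^^ N) C = (step ^^ (2 * N)) C)"
  proof (intro iffI allI impI ballI)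
    fix C assume *: "\<forall>c\<in>X. (F ^^ N) c = (F ^^ (2 * N)) c" and "C < m ^ (n * L)"
    have "decode L ((step ^^ N) C) = decode L ((step ^^ (2 * N)) C)"
      unfolding step_def decode_funpow_code_step[OF L(1)] using * decode_in_configs by blast
    then show "(step ^^ N) C = (step ^^ (2 * N)) C"
      by (rule decode_inj[OF L(1)]) (intro less \<open>C < m ^ (n * L)\<close>)+
  next
    fix c assume *: "\<forall>C<m ^ (n * L). (step ^^ N) C = (step ^^ (2 * N)) C" and "c \<in> X"
    show "(F ^^ N) c = (F ^^ (2 * N)) c"
    proof (rule powers_eq_if_periodic[OF _ L(2) _ \<open>c \<in> X\<close>])
      fix c assume "c \<in> X" "\<And>i. c (i mod int L) = c i"
      then obtain C where C: "C < m ^ (n * L)" "decode L C = c" by (rule decode_surj[OF L(1)])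
      have "decode L ((step ^^ N) C) = decode L ((step ^^ (2 * N)) C)" using * C(1) by simp
      then show "(F ^^ N) c = (F ^^ (2 * N)) c"
        by (simp only: step_def decode_funpow_code_step[OF L(1)] C(2))
    qed simp
  qed
  moreover define S where "S = (\<Sum>C<m ^ (n * L). 1 - of_bool ((step ^^ N) C = (step ^^ (2 * N)) C) :: nat)"
  have "S = 0 \<longleftrightarrow> (\<forall>C<m ^ (n * L). (step ^^ N) C = (step ^^ (2 * N)) C)"
    unfolding S_def by (subst sum_eq_0_iff) (auto simp: of_bool_def)
  moreover have "periodicity_test code m n r N = 1 - S"
    unfolding periodicity_test_def S_def L_def step_def ..
  ultimately show ?thesis by (cases "S = 0") simp_all
qed

lemma equicontinuity_test_eq: "equicontinuity_test code = (if Metric_space.equicontinuous X config_dist F then 1 else 0)"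
  unfolding equicontinuity_test_def One_nat_def code_nth_lca_code periodicity_test_eq equicontinuous_iff ..

end

theorem theorem2p7:
  shows "decidable_on lca_instances lca_code lca_sensitive \<and>
    decidable_on lca_instances lca_code lca_equicontinuous"
proof -
  have inst: "lca_instance m n r A" if "(m, n, r, A) \<in> lca_instances" for m n r A
    using that by (auto simp: lca_instances_def lca_instance_def)
  have equi: "equicontinuity_test (lca_code x) = (if lca_equicontinuous x then 1 else 0)" if "x \<in> lca_instances" for x
  proof -
    obtain m n r A where x: "x = (m, n, r, A)" by (cases x)
    show ?thesis
      using lca_instance.equicontinuity_test_eq[OF inst] that unfolding x by (simp add: lca_equicontinuous_def)
  qed
  \<comment> \<open>Sensitivity is the negation of equicontinuity, so the complementary value
    decides it.\<close>
  have sens: "1 - equicontinuity_test (lca_code x) = (if lca_sensitive x then 1 else 0)" if "x \<in> lca_instances" for x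
  proof -
    obtain m n r A where x: "x = (m, n, r, A)" by (cases x)
    show ?thesis
      using lca_instance.sensitive_iff[OF inst] equi that unfolding x
      by (simp add: lca_sensitive_def lca_equicontinuous_def)
  qed
  obtain p where p: "\<And>c. computes p [c] (equicontinuity_test c)"
    using recursive_in_equicontinuity_test by (auto simp: recursive_in_def)
  have "recursive_in [\<lambda>c. c] (\<lambda>c. 1 - equicontinuity_test c)"
    by (intro recursive_in_diff recursive_in_const recursive_in_equicontinuity_test)
  then obtain q where q: "\<And>c. computes q [c] (1 - equicontinuity_test c)"
    by (auto simp: recursive_in_def)
  show ?thesis
    unfolding decidable_on_def
  proof (intro conjI)
    show "\<exists>f. \<forall>x\<in>lca_instances. computes f [lca_code x] (if lca_sensitive x then 1 else 0)"
      using q by (auto simp flip: sens)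
    show "\<exists>f. \<forall>x\<in>lca_instances. computes f [lca_code x] (if lca_equicontinuous x then 1 else 0)"
      using p by (auto simp flip: equi)
  qed
qed

end
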